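(* Let $\mathcal{S}$ be a trajectory set for which assumption $(L)$-a.e. and property $(P)$ hold. Let $\{f_j\}_{j\ge0}$ be a real-valued non-negative supermartingale sequence on $\mathcal{S}$ and let $0\le a<b$. Let $\rho_k,\tau_k$ be the upcrossing times of $[a,b]$: $\tau_0\equiv0$ and, recursively, $$\rho_k(S)=\inf\{n:\tau_k(S)\le n,\ f_n(S)\le a\}\ (k\ge0),\qquad \tau_k(S)=\inf\{n:\rho_{k-1}(S)\le n,\ f_n(S)\ge b\}\ (k\ge1),$$ with $n$ ranging over the non-negative integers and $\inf\emptyset=\infty$. Then for every $k\ge0$, $$\overline{I}(\mathbf{1}_{\{\tau_{k+1}<\infty\}})\le\frac{a}{b}\,\overline{I}(\mathbf{1}_{\{\rho_k<\infty\}})\le\frac{a}{b}\,\overline{I}(\mathbf{1}_{\{\tau_k<\infty\}}),$$ and so $$\overline{I}(\mathbf{1}_{\{\tau_{k+1}<\infty\}})\le\Big(\frac{a}{b}\Big)^{k+1}\overline{I}(\mathbf{1}_{\{\rho_0<\infty\}})\le\Big(\frac{a}{b}\Big)^{k+1}.$$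
   Context: Fix $s_0\in\mathbb{R}$. A trajectory set $\mathcal{S}$ is a set of real sequences $S=(S_i)_{i\ge 0}$ with $S_0=s_0$. For $S\in\mathcal{S}$ and an integer $j\ge 0$, the node $(S,j)$ stands for $\mathcal{S}_{(S,j)}=\{\tilde S\in\mathcal{S}:\tilde S_i=S_i,\ 0\le i\le j\}$. $\mathcal{H}_{(S,j)}$ is the set of sequences $H=(H_i)_{i\ge j}$ of functions $H_i:\mathcal{S}_{(S,j)}\to\mathbb{R}$ that are non-anticipative: $H_i(\tilde S)=H_i(\hat S)$ whenever $\tilde S_k=\hat S_k$ for $j\le k\le i$. For $V\in\mathbb{R}$, $H\in\mathcal{H}_{(S,j)}$, $n\ge j$, put $\Pi^{V,H}_{j,n}(\tilde S)=V+\sum_{i=j}^{n-1}H_i(\tilde S)(\tilde S_{i+1}-\tilde S_i)$ for $\tilde S\in\mathcal{S}_{(S,j)}$. $\mathcal{E}_{(S,j)}$ is the set of all such functions $\Pi^{V,H}_{j,n}$, and $\mathcal{E}^+_{(S,j)}$ the set of its non-negative elements. $Q$ is the set of all functions $\mathcal{S}\to[-\infty,\infty]$ and $P\subseteq Q$ the set of non-negative ones (not to be confused with property $(P)$ below). Conventions: $0\cdot(\pm\infty)=0$, $\infty+(-\infty)=\infty$, $u-v=u+(-v)$, $\inf\emptyset=\infty$. For $f\in Q$ and a node $(S,j)$, $\overline{\sigma}_jf(S)=\inf\sum_{m\ge 0}V^m$, the infimum being over all choices of $f_0=\Pi^{V^0,H^0}_{j,n_0}\in\mathcal{E}_{(S,j)}$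 and, for $m\ge1$, $f_m=\liminf_{n\to\infty}\Pi^{V^m,H^m}_{j,n}$ with $\Pi^{V^m,H^m}_{j,n}\in\mathcal{E}^+_{(S,j)}$ for all $n\ge j$, such that $f\le\sum_{m\ge0}f_m$ on $\mathcal{S}_{(S,j)}$. For $f\in P$, $\overline{I}_jf(S)=\inf\sum_{m\ge1}V^m$ over all $f_m=\liminf_{n\to\infty}\Pi^{V^m,H^m}_{j,n}$, $m\ge1$, with $\Pi^{V^m,H^m}_{j,n}\in\mathcal{E}^+_{(S,j)}$ for all $n\ge j$, such that $f\le\sum_{m\ge1}f_m$ on $\mathcal{S}_{(S,j)}$. Since all trajectories start at $s_0$, $\overline{I}f:=\overline{I}_0f$ does not depend on $S$. A set $E\subseteq\mathcal{S}$ is null if $\overline{I}(\mathbf{1}_E)=0$; a property holds a.e. if it holds off a null set. Property $(L_{(S,j)})$: whenever $\Pi^{V,H}_{j,n_f}\in\mathcal{E}_{(S,j)}$ and $f_m=\liminf_{n\to\infty}\Pi^{V^m,H^m}_{j,n}$ with $\Pi^{V^m,H^m}_{j,n}\in\mathcal{E}^+_{(S,j)}$ for all $n\ge j$, $m\ge1$, satisfy $\Pi^{V,H}_{j,n_f}\le\sum_{m\ge1}f_m$ on $\mathcal{S}_{(S,j)}$, then $V\le\sum_{m\ge1}V^m$. Assumption $(L)$-a.e.: $(L_{(S,0)})$ holds, and $\{S\in\mathcal{S}:\exists j\ge0\text{ such that }(L_{(S,j)})\text{ fails}\}$ is a null set. A node $(S,j)$ is an up-down node if there are $S^1,S^2\in\mathcal{S}_{(S,j)}$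 with $S^1_{j+1}<S_j<S^2_{j+1}$. Property $(P)$ of $\mathcal{S}$: whenever $(S,k)$ is an up-down node such that $(L_{(S,k)})$ holds and $(L_{(S,k+1)})$ fails, there are $S^1,S^2\in\mathcal{S}_{(S,k)}$ such that $S^1_{k+1}>S_{k+1}>S^2_{k+1}$ and $(L_{(S^n,k+1)})$ holds for $n=1,2$. A sequence $\{f_j\}_{j\ge0}$ in $Q$ is a supermartingale if it is non-anticipative ($f_j$ is constant on $\mathcal{S}_{(S,j)}$ for all $S\in\mathcal{S}$ and all $j$) and for each $j\ge0$, $\overline{\sigma}_jf_{j+1}\le f_j$ a.e. *)

theory Defs
  imports Complex_Main "HOL-Library.Extended_Real" "HOL-Library.Extended_Nat"
    "HOL-Library.Indicator_Function"
begin

text \<open>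
  Functions on a trajectory set \<open>T\<close> (elements of \<open>Q\<close>, portfolios, stopping times) are modelled as
  total functions on sequences; every notion below only looks at their values on \<open>T\<close>.
  The arithmetic of \<^typ>\<open>ereal\<close> satisfies \<open>\<infinity> + (-\<infinity>) = \<infinity>\<close>, \<open>0 * (\<plusminus>\<infinity>) = 0\<close> and \<open>Inf {} = \<infinity>\<close>.
\<close>

type_synonym traj = "nat \<Rightarrow> real"

definition trajectory_set :: "real \<Rightarrow> traj set \<Rightarrow> bool" where
  "trajectory_set s0 T \<longleftrightarrow> (\<forall>S\<in>T. S 0 = s0)"

definition node :: "traj set \<Rightarrow> traj \<Rightarrow> nat \<Rightarrow> traj set" where
  "node T S j = {S' \<in> T. \<forall>i\<le>j. S' i = S i}"

definition hedges :: "traj set \<Rightarrow> traj \<Rightarrow> nat \<Rightarrow> (nat \<Rightarrow> traj \<Rightarrow> real) set" where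
  "hedges T S j = {H. \<forall>i\<ge>j. \<forall>S1\<in>node T S j. \<forall>S2\<in>node T S j.
     (\<forall>k. j \<le> k \<and> k \<le> i \<longrightarrow> S1 k = S2 k) \<longrightarrow> H i S1 = H i S2}"

definition portfolio :: "real \<Rightarrow> (nat \<Rightarrow> traj \<Rightarrow> real) \<Rightarrow> nat \<Rightarrow> nat \<Rightarrow> traj \<Rightarrow> real" where
  "portfolio V H j n S = V + (\<Sum>i=j..<n. H i S * (S (Suc i) - S i))"

definition nonneg_portfolio ::
  "traj set \<Rightarrow> traj \<Rightarrow> nat \<Rightarrow> real \<Rightarrow> (nat \<Rightarrow> traj \<Rightarrow> real) \<Rightarrow> bool" where
  "nonneg_portfolio T S j V H \<longleftrightarrow>
     H \<in> hedges T S j \<and> (\<forall>n\<ge>j. \<forall>S'\<in>node T S j. 0 \<le> portfolio V H j n S')"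

definition liminf_portfolio :: "real \<Rightarrow> (nat \<Rightarrow> traj \<Rightarrow> real) \<Rightarrow> nat \<Rightarrow> traj \<Rightarrow> ereal" where
  "liminf_portfolio V H j S = liminf (\<lambda>n. ereal (portfolio V H j n S))"

text \<open>
  In the next three definitions the families indexed by \<open>m \<ge> 1\<close> are reindexed to start at \<open>0\<close>,
  and the data with index \<open>0\<close> in \<open>upper_sigma\<close> are named \<open>V0\<close>, \<open>H0\<close>, \<open>n0\<close>.
\<close>

definition upper_sigma :: "traj set \<Rightarrow> nat \<Rightarrow> (traj \<Rightarrow> ereal) \<Rightarrow> traj \<Rightarrow> ereal" where
  "upper_sigma T j f S = Inf {ereal V0 + (\<Sum>m. ereal (V m)) | V0 H0 n0 V H.
     H0 \<in> hedges T S j \<and> j \<le> n0 \<and> (\<forall>m. nonneg_portfolio T S j (V m) (H m)) \<and>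
     (\<forall>S'\<in>node T S j.
        f S' \<le> ereal (portfolio V0 H0 j n0 S') + (\<Sum>m. liminf_portfolio (V m) (H m) j S'))}"

definition upper_I :: "traj set \<Rightarrow> nat \<Rightarrow> (traj \<Rightarrow> ereal) \<Rightarrow> traj \<Rightarrow> ereal" where
  "upper_I T j f S = Inf {(\<Sum>m. ereal (V m)) | V H.
     (\<forall>m. nonneg_portfolio T S j (V m) (H m)) \<and>
     (\<forall>S'\<in>node T S j. f S' \<le> (\<Sum>m. liminf_portfolio (V m) (H m) j S'))}"

definition prop_L :: "traj set \<Rightarrow> traj \<Rightarrow> nat \<Rightarrow> bool" where
  "prop_L T S j \<longleftrightarrow> (\<forall>V0 H0 n0 V H.
     H0 \<in> hedges T S j \<and> j \<le> n0 \<and> (\<forall>m. nonneg_portfolio T S j (V m) (H m)) \<and>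
     (\<forall>S'\<in>node T S j.
        ereal (portfolio V0 H0 j n0 S') \<le> (\<Sum>m. liminf_portfolio (V m) (H m) j S'))
     \<longrightarrow> ereal V0 \<le> (\<Sum>m. ereal (V m)))"

text \<open>The choice of the trajectory is immaterial, see \<open>upper_I0_eq\<close> below.\<close>

definition upper_I0 :: "traj set \<Rightarrow> (traj \<Rightarrow> ereal) \<Rightarrow> ereal" where
  "upper_I0 T f = upper_I T 0 f (SOME S. S \<in> T)"

lemma node_0: "trajectory_set s0 T \<Longrightarrow> S \<in> T \<Longrightarrow> node T S 0 = T"
  unfolding trajectory_set_def node_def by (smt (verit) Collect_cong Collect_mem_eq le_zero_eq)

lemma upper_I0_eq:
  assumes "trajectory_set s0 T" "S \<in> T"
  shows "upper_I0 T f = upper_I T 0 f S"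
proof -
  have "(SOME S. S \<in> T) \<in> T"
    using assms(2) by (metis someI)
  then have "node T (SOME S. S \<in> T) 0 = node T S 0"
    using assms node_0 by metis
  then show ?thesis
    by (simp add: upper_I0_def upper_I_def nonneg_portfolio_def hedges_def)
qed

definition null_set :: "traj set \<Rightarrow> traj set \<Rightarrow> bool" where
  "null_set T E \<longleftrightarrow> E \<subseteq> T \<and> upper_I0 T (indicator E) = 0"

definition holds_ae :: "traj set \<Rightarrow> (traj \<Rightarrow> bool) \<Rightarrow> bool" where
  "holds_ae T P \<longleftrightarrow> (\<exists>E. null_set T E \<and> (\<forall>S\<in>T - E. P S))"

definition L_ae :: "traj set \<Rightarrow> bool" where
  "L_ae T \<longleftrightarrow> (\<forall>S\<in>T. prop_L T S 0) \<and> null_set T {S \<in> T. \<exists>j. \<not> prop_L T S j}"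

definition up_down_node :: "traj set \<Rightarrow> traj \<Rightarrow> nat \<Rightarrow> bool" where
  "up_down_node T S j \<longleftrightarrow>
     (\<exists>S1\<in>node T S j. \<exists>S2\<in>node T S j. S1 (Suc j) < S j \<and> S j < S2 (Suc j))"

definition prop_P :: "traj set \<Rightarrow> bool" where
  "prop_P T \<longleftrightarrow> (\<forall>S\<in>T. \<forall>k.
     up_down_node T S k \<and> prop_L T S k \<and> \<not> prop_L T S (Suc k) \<longrightarrow>
     (\<exists>S1\<in>node T S k. \<exists>S2\<in>node T S k.
        S1 (Suc k) > S (Suc k) \<and> S (Suc k) > S2 (Suc k) \<and>
        prop_L T S1 (Suc k) \<and> prop_L T S2 (Suc k)))"

definition supermartingale :: "traj set \<Rightarrow> (nat \<Rightarrow> traj \<Rightarrow> ereal) \<Rightarrow> bool" where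
  "supermartingale T f \<longleftrightarrow>
     (\<forall>j. \<forall>S\<in>T. \<forall>S'\<in>node T S j. f j S' = f j S) \<and>
     (\<forall>j. holds_ae T (\<lambda>S. upper_sigma T j (f (Suc j)) S \<le> f j S))"

text \<open>Upcrossing times are valued in \<^typ>\<open>enat\<close>, where \<open>Inf {} = \<infinity>\<close>.\<close>

fun up_tau :: "(nat \<Rightarrow> traj \<Rightarrow> real) \<Rightarrow> real \<Rightarrow> real \<Rightarrow> nat \<Rightarrow> traj \<Rightarrow> enat"
  and up_rho :: "(nat \<Rightarrow> traj \<Rightarrow> real) \<Rightarrow> real \<Rightarrow> real \<Rightarrow> nat \<Rightarrow> traj \<Rightarrow> enat" where
  "up_tau f a b 0 S = 0"
| "up_tau f a b (Suc k) S = Inf {enat n | n. up_rho f a b k S \<le> enat n \<and> f n S \<ge> b}"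
| "up_rho f a b k S = Inf {enat n | n. up_tau f a b k S \<le> enat n \<and> f n S \<le> a}"

end

theory Submission
  imports Defs "HOL-Library.Nat_Bijection"
begin

text \<open>
  Off a null set a supermartingale can be superhedged step by step, up to an error \<open>e / 2 ^ n\<close> at
  time \<open>n\<close>, by one non-negative portfolio: at an up-down node the countably many portfolios in
  \<^const>\<open>upper_sigma\<close> merge into one, and at any other node the price fails to stay put only on a
  null set. Trading in this portfolio between \<open>\<rho>\<close> and \<open>\<tau>\<close> turns capital \<open>a + e\<close> at \<open>\<rho>\<close> into at least
  \<open>b\<close> at \<open>\<tau>\<close>. A superhedge of the event \<open>\<rho> < \<infinity>\<close> is worth at least \<open>1\<close> at \<open>\<rho>\<close> by property (L), so
  \<open>(a + e) / b\<close> times its cost superhedges the event \<open>\<tau> < \<infinity>\<close>; finally \<open>e\<close> tends to \<open>0\<close>.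
\<close>

subsection \<open>Portfolios and one-step superhedging\<close>

lemma node_self: "S \<in> T \<Longrightarrow> S \<in> node T S j"
  by (simp add: node_def)

lemma nodeD: "S' \<in> node T S j \<Longrightarrow> S' \<in> T" "S' \<in> node T S j \<Longrightarrow> i \<le> j \<Longrightarrow> S' i = S i"
  by (auto simp: node_def)

lemma node_subset: "S' \<in> node T S j \<Longrightarrow> j \<le> l \<Longrightarrow> node T S' l \<subseteq> node T S j"
  by (auto simp: node_def)

lemma node_eq: "S' \<in> node T S j \<Longrightarrow> node T S' j = node T S j"
  by (auto simp: node_def)

lemma hedgesI:
  assumes "\<And>i S1 S2. j \<le> i \<Longrightarrow> S1 \<in> node T S j \<Longrightarrow> S2 \<in> node T S j \<Longrightarrow>
    (\<And>k. j \<le> k \<Longrightarrow> k \<le> i \<Longrightarrow> S1 k = S2 k) \<Longrightarrow> H i S1 = H i S2"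
  shows "H \<in> hedges T S j"
  unfolding hedges_def mem_Collect_eq by (intro allI impI ballI assms) blast+

lemma hedgesD:
  assumes "H \<in> hedges T S j" "j \<le> i" "S1 \<in> node T S j" "S2 \<in> node T S j"
    and "\<And>k. j \<le> k \<Longrightarrow> k \<le> i \<Longrightarrow> S1 k = S2 k"
  shows "H i S1 = H i S2"
  using assms unfolding hedges_def mem_Collect_eq by blast

lemma hedges_comp:
  assumes "H \<in> hedges T S j"
  shows "(\<lambda>i S. \<phi> i (H i S)) \<in> hedges T S j"
  by (rule hedgesI, rule arg_cong[where f = "\<phi> _"], rule hedgesD[OF assms])

lemma prop_L_cong_node: "node T S' j = node T S j \<Longrightarrow> prop_L T S' j = prop_L T S j"
  by (simp add: prop_L_def nonneg_portfolio_def hedges_def)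

text \<open>Paths in \<open>node T S' l\<close> share their whole past up to \<open>l\<close>, so
  agreement from \<open>l\<close> to \<open>i\<close> already gives agreement from \<open>j\<close>
  to \<open>i\<close>.\<close>

lemma hedges_restrict:
  assumes H: "H \<in> hedges T S j" and S': "S' \<in> node T S j" and "j \<le> l"
  shows "H \<in> hedges T S' l"
proof (rule hedgesI)
  fix i S1 S2
  assume i: "l \<le> i" and S12: "S1 \<in> node T S' l" "S2 \<in> node T S' l"
    and eq: "\<And>k. l \<le> k \<Longrightarrow> k \<le> i \<Longrightarrow> S1 k = S2 k"
  have "S1 k = S2 k" if "k \<le> i" for k
    using eq that nodeD(2)[OF S12(1), of k] nodeD(2)[OF S12(2), of k] by (cases "l \<le> k") auto
  then show "H i S1 = H i S2"
    using node_subset[OF S' \<open>j \<le> l\<close>] S12 i \<open>j \<le> l\<close> by (intro hedgesD[OF H]) auto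
qed

lemma portfolio_initial [simp]: "portfolio V H j j S = V"
  by (simp add: portfolio_def)

lemma portfolio_Suc:
  "j \<le> n \<Longrightarrow> portfolio V H j (Suc n) S = portfolio V H j n S + H n S * (S (Suc n) - S n)"
  by (simp add: portfolio_def)

lemma portfolio_one_step: "portfolio V H j (Suc j) S = V + H j S * (S (Suc j) - S j)"
  by (simp add: portfolio_Suc)

text \<open>Before time \<open>l\<close> the positions and moves of \<open>S'\<close> and
  \<open>S''\<close> coincide, so a portfolio can be restarted at \<open>l\<close> with its current
  value as new capital. This is what allows (L) to be applied at later nodes.\<close>

lemma portfolio_continue:
  assumes H: "H \<in> hedges T S j" and S': "S' \<in> node T S j" and "j \<le> l" "l \<le> n"
    and S'': "S'' \<in> node T S' l"
  shows "portfolio (portfolio V H j l S') H l n S'' = portfolio V H j n S''"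
proof -
  have S''j: "S'' \<in> node T S j"
    using node_subset[OF S' \<open>j \<le> l\<close>] S'' by auto
  have "H i S' * (S' (Suc i) - S' i) = H i S'' * (S'' (Suc i) - S'' i)"
    if "i \<in> {j..<l}" for i
  proof -
    have "S' k = S'' k" if "k \<le> i" for k
      using nodeD(2)[OF S''] that \<open>i \<in> {j..<l}\<close> by auto
    then have "H i S' = H i S''"
      using S' S''j that by (intro hedgesD[OF H]) auto
    then show ?thesis
      using nodeD(2)[OF S''] that by auto
  qed
  then have "(\<Sum>i=j..<l. H i S' * (S' (Suc i) - S' i)) = (\<Sum>i=j..<l. H i S'' * (S'' (Suc i) - S'' i))"
    by (intro sum.cong) auto
  then show ?thesis
    using sum.atLeastLessThan_concat[OF \<open>j \<le> l\<close> \<open>l \<le> n\<close>, of "\<lambda>i. H i S'' * (S'' (Suc i) - S'' i)"]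
    by (simp add: portfolio_def)
qed

lemma nonneg_portfolio_continue:
  assumes H: "nonneg_portfolio T S j V H" and S': "S' \<in> node T S j" and "j \<le> l"
  shows "nonneg_portfolio T S' l (portfolio V H j l S') H"
  using assms portfolio_continue[of H T S j S' l] hedges_restrict[of H T S j S' l]
    node_subset[OF S' \<open>j \<le> l\<close>]
  by (auto simp: nonneg_portfolio_def)

lemma liminf_portfolio_continue:
  assumes "H \<in> hedges T S j" "S' \<in> node T S j" "j \<le> l" "S'' \<in> node T S' l"
  shows "liminf_portfolio (portfolio V H j l S') H l S'' = liminf_portfolio V H j S''"
  unfolding liminf_portfolio_def
proof (rule Liminf_eq)
  show "\<forall>\<^sub>F n in sequentially. ereal (portfolio (portfolio V H j l S') H l n S'') =
      ereal (portfolio V H j n S'')"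
    using eventually_ge_at_top[of l]
    by eventually_elim (simp add: portfolio_continue[OF assms(1-3) _ assms(4)])
qed

lemma liminf_portfolio_ge:
  assumes "\<And>n. n \<ge> n0 \<Longrightarrow> c \<le> portfolio V H j n S"
  shows "ereal c \<le> liminf_portfolio V H j S"
  unfolding liminf_portfolio_def
  by (rule Liminf_bounded) (auto simp: eventually_sequentially intro: assms)

lemma nonneg_portfolio_initial: "nonneg_portfolio T S j V H \<Longrightarrow> S \<in> T \<Longrightarrow> 0 \<le> V"
  using node_self[of S T j] by (force simp: nonneg_portfolio_def)

lemma nonneg_portfolio_liminf:
  "nonneg_portfolio T S j V H \<Longrightarrow> S' \<in> node T S j \<Longrightarrow> 0 \<le> liminf_portfolio V H j S'"
  using liminf_portfolio_ge[of j 0 V H j S'] by (simp add: nonneg_portfolio_def zero_ereal_def)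

section \<open>Property (L) and single time steps\<close>

lemma prop_LD:
  assumes "prop_L T S j" "H0 \<in> hedges T S j" "j \<le> n0" "\<And>m. nonneg_portfolio T S j (V m) (H m)"
    and "\<And>S'. S' \<in> node T S j \<Longrightarrow>
      ereal (portfolio V0 H0 j n0 S') \<le> (\<Sum>m. liminf_portfolio (V m) (H m) j S')"
  shows "ereal V0 \<le> (\<Sum>m. ereal (V m))"
  using assms(1)[unfolded prop_L_def, rule_format, of H0 n0 V H V0] assms(2-) by blast

text \<open>Moving the finite-horizon portfolio to the left-hand side leaves a portfolio with hedge
  \<open>- H0\<close>, restarted at \<open>l\<close> and dominated by the restarted non-negative
  portfolios. Property (L) at \<open>(S', l)\<close> then compares the capitals at time
  \<open>l\<close>.\<close>

lemma prop_L_dominate: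
  assumes H0: "H0 \<in> hedges T S j" and "j \<le> l" "l \<le> n0"
    and nn: "\<And>m. nonneg_portfolio T S j (V m) (H m)"
    and S': "S' \<in> node T S j" and L: "prop_L T S' l"
    and dom: "\<And>S''. S'' \<in> node T S' l \<Longrightarrow>
      ereal x \<le> ereal (portfolio V0 H0 j n0 S'') + (\<Sum>m. liminf_portfolio (V m) (H m) j S'')"
  shows "ereal (x - portfolio V0 H0 j l S') \<le> (\<Sum>m. ereal (portfolio (V m) (H m) j l S'))"
proof -
  define y where "y = x - portfolio V0 H0 j l S'"
  have Hm: "H m \<in> hedges T S j" for m
    using nn by (simp add: nonneg_portfolio_def)
  have "H0 \<in> hedges T S' l"
    using hedges_restrict[OF H0 S' \<open>j \<le> l\<close>] .
  then have h: "(\<lambda>i S. - H0 i S) \<in> hedges T S' l"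
    by (rule hedges_comp[where \<phi> = "\<lambda>i x. - x"])
  have "ereal (portfolio y (\<lambda>i S. - H0 i S) l n0 S'')
      \<le> (\<Sum>m. liminf_portfolio (portfolio (V m) (H m) j l S') (H m) l S'')"
    if "S'' \<in> node T S' l" for S''
  proof -
    have "portfolio y (\<lambda>i S. - H0 i S) l n0 S'' = x - portfolio V0 H0 j n0 S''"
      using portfolio_continue[OF H0 S' \<open>j \<le> l\<close> \<open>l \<le> n0\<close> that, of V0]
      by (simp add: portfolio_def y_def sum_negf)
    \<comment> \<open>Subtracting is safe even for infinite \<open>s\<close>, because
      \<open>p\<close> is real.\<close>
    moreover have "ereal (x - p) \<le> s" if "ereal x \<le> ereal p + s" for p s
      using that by (cases s) auto
    ultimately show ?thesis
      using dom[OF that] liminf_portfolio_continue[OF Hm S' \<open>j \<le> l\<close> that] by simp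
  qed
  then show ?thesis
    unfolding y_def[symmetric]
    by (intro prop_LD[OF L h \<open>l \<le> n0\<close> nonneg_portfolio_continue[OF nn S' \<open>j \<le> l\<close>]])
qed

text \<open>At a child satisfying (L), \<open>prop_L_dominate\<close> replaces every portfolio by
  its value at time \<open>Suc j\<close>, since \<open>g\<close> is constant on the node of that
  child. The positions \<open>h\<close> stay a family: their summability comes later, from the
  presence of both up and down moves.\<close>

lemma upper_sigma_one_step:
  assumes S: "S \<in> T" and less: "upper_sigma T j (\<lambda>S. ereal (g S)) S < ereal c"
    and na: "\<And>S' S''. S' \<in> T \<Longrightarrow> S'' \<in> node T S' (Suc j) \<Longrightarrow> g S'' = g S'"
  obtains V0 h0 V h where "\<And>m::nat. 0 \<le> V m" "summable V" "V0 + suminf V < c"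
    "\<And>S' m. S' \<in> node T S j \<Longrightarrow> 0 \<le> V m + h m * (S' (Suc j) - S j)"
    "\<And>S'. S' \<in> node T S j \<Longrightarrow> prop_L T S' (Suc j) \<Longrightarrow>
       ereal (g S' - (V0 + h0 * (S' (Suc j) - S j))) \<le> (\<Sum>m. ereal (V m + h m * (S' (Suc j) - S j)))"
proof -
  obtain V0 H0 n0 V H where H0: "H0 \<in> hedges T S j" and n0: "j \<le> n0"
    and nn: "\<And>m. nonneg_portfolio T S j (V m) (H m)"
    and dom: "\<And>S'. S' \<in> node T S j \<Longrightarrow>
      ereal (g S') \<le> ereal (portfolio V0 H0 j n0 S') + (\<Sum>m. liminf_portfolio (V m) (H m) j S')"
    and cost: "ereal V0 + (\<Sum>m. ereal (V m)) < ereal c"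
    using less unfolding upper_sigma_def Inf_less_iff by blast
  have V: "0 \<le> V m" for m
    using nonneg_portfolio_initial[OF nn S] .
  have fin: "(\<Sum>m. ereal (V m)) \<noteq> \<infinity>"
    using cost by auto
  have sm: "summable V"
    using summable_ereal[OF _ fin] V by auto
  have sV: "(\<Sum>m. ereal (V m)) = ereal (suminf V)"
    using suminf_ereal[OF _ fin] V by auto
  define H0' where "H0' i S = (if i < n0 then H0 i S else 0)" for i and S :: traj
  have H0': "H0' \<in> hedges T S j"
    unfolding H0'_def by (rule hedges_comp[OF H0, where \<phi> = "\<lambda>i x. if i < n0 then x else 0"])
  have p0: "portfolio V0 H0' j (max n0 (Suc j)) S' = portfolio V0 H0 j n0 S'" for S'
  proof -
    have "(\<Sum>i=j..<max n0 (Suc j). H0' i S' * (S' (Suc i) - S' i)) =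
        (\<Sum>i=j..<n0. H0 i S' * (S' (Suc i) - S' i))"
      by (rule sum.mono_neutral_cong_right) (auto simp: H0'_def)
    then show ?thesis
      by (simp add: portfolio_def)
  qed
  \<comment> \<open>A position taken at time \<open>j\<close> is a single number on the node, so it
    may be read off at \<open>S\<close>.\<close>
  have same: "K j S' = K j S" and S'j: "S' j = S j" if "K \<in> hedges T S j" "S' \<in> node T S j" for K S'
  proof -
    show "S' j = S j"
      using nodeD(2)[OF that(2)] by simp
    then show "K j S' = K j S"
      by (intro hedgesD[OF that(1) _ that(2) node_self[OF S]]) auto
  qed
  show ?thesis
  proof (rule that[of V V0 "\<lambda>m. H m j S" "H0' j S"])
    show "V0 + suminf V < c"
      using cost by (simp add: sV)
  next
    fix S' m
    assume S': "S' \<in> node T S j"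
    have "0 \<le> portfolio (V m) (H m) j (Suc j) S'" and Hm: "H m \<in> hedges T S j"
      using nn S' by (auto simp: nonneg_portfolio_def)
    then show "0 \<le> V m + H m j S * (S' (Suc j) - S j)"
      using same[OF Hm S'] S'j[OF Hm S'] by (simp add: portfolio_one_step)
  next
    fix S'
    assume S': "S' \<in> node T S j" and L: "prop_L T S' (Suc j)"
    have Hm: "H m \<in> hedges T S j" for m
      using nn by (auto simp: nonneg_portfolio_def)
    have "ereal (g S' - portfolio V0 H0' j (Suc j) S') \<le> (\<Sum>m. ereal (portfolio (V m) (H m) j (Suc j) S'))"
    proof (rule prop_L_dominate[OF H0' _ _ nn S' L])
      fix S''
      assume S'': "S'' \<in> node T S' (Suc j)"
      have "S' \<in> T"
        using S' by (simp add: node_def)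
      moreover have "S'' \<in> node T S j"
        using node_subset[OF S', of "Suc j"] S'' by auto
      ultimately show "ereal (g S') \<le> ereal (portfolio V0 H0' j (max n0 (Suc j)) S'') +
          (\<Sum>m. liminf_portfolio (V m) (H m) j S'')"
        using dom na[OF _ S''] p0 by metis
    qed auto
    then show "ereal (g S' - (V0 + H0' j S * (S' (Suc j) - S j)))
        \<le> (\<Sum>m. ereal (V m + H m j S * (S' (Suc j) - S j)))"
      using same[OF H0' S'] same[OF Hm S'] S'j[OF H0' S'] by (simp add: portfolio_one_step)
  qed (use V sm in auto)
qed

text \<open>When the price does not move, all positions drop out of the one-step inequality and only
  the capitals remain, whose total is below \<open>c\<close>.\<close>

lemma flat_step_bound:
  assumes "S \<in> T" "upper_sigma T j (\<lambda>S. ereal (g S)) S < ereal c"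
    and "\<And>S' S''. S' \<in> T \<Longrightarrow> S'' \<in> node T S' (Suc j) \<Longrightarrow> g S'' = g S'"
    and "prop_L T S (Suc j)" "S (Suc j) = S j"
  shows "g S \<le> c"
proof (rule upper_sigma_one_step[OF assms(1-3)])
  fix V0 h0 V h
  assume V: "\<And>m::nat. 0 \<le> V m" "summable V" "V0 + suminf V < c"
    and L: "\<And>S'. S' \<in> node T S j \<Longrightarrow> prop_L T S' (Suc j) \<Longrightarrow>
       ereal (g S' - (V0 + h0 * (S' (Suc j) - S j))) \<le> (\<Sum>m. ereal (V m + h m * (S' (Suc j) - S j)))"
  have "ereal (g S - V0) \<le> (\<Sum>m. ereal (V m))"
    using L[OF node_self[OF assms(1)] assms(4)] assms(5) by simp
  also have "\<dots> = ereal (suminf V)"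
    using V(2) suminf_ereal'[of V] by auto
  finally show "g S \<le> c"
    using V(3) by simp
qed

text \<open>
  At an up-down node, non-negativity bounds the positions by the initial capitals, so a countable
  family of portfolios can be summed into one. Property (P) gives non-negativity at children
  violating (L), as the payoff is affine in the move and non-negative at children on both sides.
\<close>

lemma up_down_step_hedge:
  assumes S: "S \<in> T" and less: "upper_sigma T j (\<lambda>S. ereal (g S)) S < ereal c"
    and na: "\<And>S' S''. S' \<in> T \<Longrightarrow> S'' \<in> node T S' (Suc j) \<Longrightarrow> g S'' = g S'"
    and nonneg: "\<And>S'. S' \<in> T \<Longrightarrow> 0 \<le> g S'"
    and P: "prop_P T" and LS: "prop_L T S j" and ud: "up_down_node T S j"
  shows "\<exists>h. \<forall>S'\<in>node T S j. 0 \<le> c + h * (S' (Suc j) - S j) \<and>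
    (prop_L T S' (Suc j) \<longrightarrow> g S' \<le> c + h * (S' (Suc j) - S j))"
proof (rule upper_sigma_one_step[OF assms(1-3)])
  fix V0 h0 V h
  assume V: "\<And>m::nat. 0 \<le> V m" "summable V" "V0 + suminf V < c"
    and pos: "\<And>S' m. S' \<in> node T S j \<Longrightarrow> 0 \<le> V m + h m * (S' (Suc j) - S j)"
    and L: "\<And>S'. S' \<in> node T S j \<Longrightarrow> prop_L T S' (Suc j) \<Longrightarrow>
       ereal (g S' - (V0 + h0 * (S' (Suc j) - S j))) \<le> (\<Sum>m. ereal (V m + h m * (S' (Suc j) - S j)))"
  obtain S1 S2 where S12: "S1 \<in> node T S j" "S2 \<in> node T S j" "S1 (Suc j) < S j" "S j < S2 (Suc j)"
    using ud by (auto simp: up_down_node_def)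
  \<comment> \<open>The down move \<open>S1\<close> bounds \<open>h m\<close> from above and the up
    move \<open>S2\<close> bounds it from below, each by \<open>V m\<close> divided by the size of
    the move; \<open>K\<close> adds the two factors.\<close>
  define K where "K = 1 / (S j - S1 (Suc j)) + 1 / (S2 (Suc j) - S j)"
  have "\<bar>h m\<bar> \<le> V m * K" for m
  proof -
    have "h m \<le> V m * (1 / (S j - S1 (Suc j)))" "- h m \<le> V m * (1 / (S2 (Suc j) - S j))"
      using pos[OF S12(1), of m] pos[OF S12(2), of m] S12(3,4) by (simp_all add: field_simps)
    moreover have "0 \<le> V m * (1 / (S j - S1 (Suc j)))" "0 \<le> V m * (1 / (S2 (Suc j) - S j))"
      using V(1) S12(3,4) by simp_all
    ultimately show ?thesis
      unfolding K_def distrib_left by linarith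
  qed
  then have h: "summable h"
    by (intro summable_comparison_test[OF _ summable_mult2[OF V(2), of K]]) auto
  define H where "H = h0 + suminf h"
  have good: "g S' \<le> c + H * (S' (Suc j) - S j)"
    if "S' \<in> node T S j" "prop_L T S' (Suc j)" for S'
  proof -
    define d where "d = S' (Suc j) - S j"
    have "ereal (g S' - (V0 + h0 * d)) \<le> (\<Sum>m. ereal (V m + h m * d))"
      using L[OF that] by (simp add: d_def)
    also have "\<dots> = ereal (\<Sum>m. V m + h m * d)"
      using suminf_ereal'[of "\<lambda>m. V m + h m * d"] summable_add[OF V(2) summable_mult2[OF h, of d]]
      by auto
    also have "(\<Sum>m. V m + h m * d) = suminf V + suminf h * d"
      using suminf_add[OF V(2) summable_mult2[OF h, of d]] suminf_mult2[OF h, of d] by simp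
    finally show ?thesis
      using V(3) by (simp add: H_def d_def algebra_simps)
  qed
  have "0 \<le> c + H * (S' (Suc j) - S j)" if S': "S' \<in> node T S j" for S'
  proof (cases "prop_L T S' (Suc j)")
    case True
    then show ?thesis
      using good[OF S'] nonneg[of S'] S' by (fastforce simp: node_def)
  next
    case False
    have "S' \<in> T" "S' j = S j"
      using S' by (auto simp: node_def)
    \<comment> \<open>Property (P) speaks about the path whose child violates (L), so it is applied
      to \<open>S'\<close>, which shares its node at time \<open>j\<close> with
      \<open>S\<close>.\<close>
    have nodes: "node T S' j = node T S j"
      by (rule node_eq[OF S'])
    have "up_down_node T S' j"
      using ud \<open>S' j = S j\<close> by (simp add: up_down_node_def nodes)
    then obtain R1 R2 where R: "R1 \<in> node T S j" "R2 \<in> node T S j"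
      "R1 (Suc j) > S' (Suc j)" "S' (Suc j) > R2 (Suc j)" "prop_L T R1 (Suc j)" "prop_L T R2 (Suc j)"
      using P[unfolded prop_P_def, rule_format, OF \<open>S' \<in> T\<close>, of j] prop_L_cong_node[OF nodes] LS False
      unfolding nodes by blast
    have "0 \<le> c + H * (R1 (Suc j) - S j)" "0 \<le> c + H * (R2 (Suc j) - S j)"
      using good[OF R(1,5)] good[OF R(2,6)] nonneg[of R1] nonneg[of R2] R(1,2)
      by (auto simp: node_def)
    moreover have "H * (R2 (Suc j) - S j) \<le> H * (S' (Suc j) - S j) \<or>
        H * (R1 (Suc j) - S j) \<le> H * (S' (Suc j) - S j)"
      using R(3,4) by (cases "0 \<le> H") (auto intro: mult_left_mono mult_left_mono_neg)
    ultimately show ?thesis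
      by linarith
  qed
  with good show "\<exists>h. \<forall>S'\<in>node T S j. 0 \<le> c + h * (S' (Suc j) - S j) \<and>
    (prop_L T S' (Suc j) \<longrightarrow> g S' \<le> c + h * (S' (Suc j) - S j))"
    by blast
qed

subsection \<open>The outer functional\<close>

lemma nonneg_portfolio_0_iff:
  assumes "trajectory_set s0 T" "S0 \<in> T"
  shows "nonneg_portfolio T S0 0 V H \<longleftrightarrow>
    H \<in> hedges T S0 0 \<and> (\<forall>n. \<forall>S\<in>T. 0 \<le> portfolio V H 0 n S)"
  by (simp add: nonneg_portfolio_def node_0[OF assms])

lemma upper_I0_le:
  assumes T: "trajectory_set s0 T" "S0 \<in> T"
    and "\<And>m. nonneg_portfolio T S0 0 (V m) (H m)"
    and "\<And>S. S \<in> T \<Longrightarrow> f S \<le> (\<Sum>m. liminf_portfolio (V m) (H m) 0 S)"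
  shows "upper_I0 T f \<le> (\<Sum>m. ereal (V m))"
  unfolding upper_I0_eq[OF T] upper_I_def
  by (rule Inf_lower) (use assms node_0[OF T] in blast)

lemma upper_I0_lessE:
  assumes T: "trajectory_set s0 T" "S0 \<in> T" and "upper_I0 T f < c"
  obtains V H where "\<And>m. nonneg_portfolio T S0 0 (V m) (H m)"
    "\<And>S. S \<in> T \<Longrightarrow> f S \<le> (\<Sum>m. liminf_portfolio (V m) (H m) 0 S)"
    "(\<Sum>m. ereal (V m)) < c"
  using assms(3) unfolding upper_I0_eq[OF T] upper_I_def Inf_less_iff node_0[OF T] by blast

lemma upper_I0_nonneg:
  assumes T: "trajectory_set s0 T" "S0 \<in> T"
  shows "0 \<le> upper_I0 T f"
  unfolding upper_I0_eq[OF T] upper_I_def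
  by (rule Inf_greatest) (auto intro!: suminf_0_le nonneg_portfolio_initial[OF _ T(2), of 0])

lemma indicator_ereal_nonneg [simp]: "0 \<le> (indicator A x :: ereal)"
  by (simp add: indicator_def)

lemma upper_I0_mono:
  assumes "\<And>S. S \<in> T \<Longrightarrow> f S \<le> g S"
  shows "upper_I0 T f \<le> upper_I0 T g"
  unfolding upper_I0_def upper_I_def
  by (rule Inf_superset_mono) (use assms in \<open>blast intro: nodeD(1) order_trans\<close>)

text \<open>Both inequalities compare finite partial sums: the first \<open>N\<close> codes lie in a
  square, and every rectangle is a finite set of codes. With this, a sequence of superhedges can be
  listed as one superhedge.\<close>

lemma suminf_ereal_prod_decode:
  fixes f :: "nat \<times> nat \<Rightarrow> ereal"
  assumes pos: "\<And>p. 0 \<le> f p"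
  shows "(\<Sum>k. f (prod_decode k)) = (\<Sum>n. \<Sum>m. f (n, m))"
proof (rule antisym)
  show "(\<Sum>k. f (prod_decode k)) \<le> (\<Sum>n. \<Sum>m. f (n, m))"
  proof (intro suminf_bound allI)
    fix N
    obtain M where "fst ` prod_decode ` {..<N} \<union> snd ` prod_decode ` {..<N} \<subseteq> {..<M}"
      using finite_nat_iff_bounded[of "fst ` prod_decode ` {..<N} \<union> snd ` prod_decode ` {..<N}"] by auto
    then have M: "prod_decode ` {..<N} \<subseteq> {..<M} \<times> {..<M}"
      by (simp add: image_subset_iff mem_Times_iff)
    have "(\<Sum>k<N. f (prod_decode k)) = sum f (prod_decode ` {..<N})"
      by (simp add: sum.reindex inj_prod_decode)
    also have "\<dots> \<le> sum f ({..<M} \<times> {..<M})"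
      using M by (intro sum_mono2 pos) auto
    also have "\<dots> = (\<Sum>n<M. \<Sum>m<M. f (n, m))"
      by (simp add: sum.cartesian_product)
    also have "\<dots> \<le> (\<Sum>n<M. \<Sum>m. f (n, m))"
      by (intro sum_mono sum_le_suminf pos) (auto simp: summable_ereal_pos pos)
    also have "\<dots> \<le> (\<Sum>n. \<Sum>m. f (n, m))"
      by (intro sum_le_suminf) (auto simp: summable_ereal_pos pos suminf_0_le)
    finally show "(\<Sum>k<N. f (prod_decode k)) \<le> (\<Sum>n. \<Sum>m. f (n, m))" .
  qed (rule pos)
  show "(\<Sum>n. \<Sum>m. f (n, m)) \<le> (\<Sum>k. f (prod_decode k))"
  proof (intro suminf_bound allI)
    fix N
    have "(\<Sum>n<N. \<Sum>m. f (n, m)) = (\<Sum>m. \<Sum>n<N. f (n, m))"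
      by (rule suminf_sum_ereal[symmetric]) (rule pos)
    also have "\<dots> \<le> (\<Sum>k. f (prod_decode k))"
    proof (intro suminf_bound allI)
      fix M
      have "(\<Sum>m<M. \<Sum>n<N. f (n, m)) = sum f ({..<N} \<times> {..<M})"
        by (subst sum.swap) (simp add: sum.cartesian_product)
      also have "\<dots> = (\<Sum>k\<in>prod_encode ` ({..<N} \<times> {..<M}). f (prod_decode k))"
        by (simp add: sum.reindex inj_prod_encode)
      also have "\<dots> \<le> (\<Sum>k. f (prod_decode k))"
        by (intro sum_le_suminf pos) (auto simp: summable_ereal_pos pos)
      finally show "(\<Sum>m<M. \<Sum>n<N. f (n, m)) \<le> (\<Sum>k. f (prod_decode k))" .
    qed (simp add: sum_nonneg pos)
    finally show "(\<Sum>n<N. \<Sum>m. f (n, m)) \<le> (\<Sum>k. f (prod_decode k))" .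
  qed (simp add: suminf_0_le pos)
qed

text \<open>Countable subadditivity: near-optimal superhedges of all the \<open>g n\<close>, taken
  together, form one countable family of portfolios superhedging \<open>f\<close>.\<close>

lemma upper_I0_le_suminf:
  assumes T: "trajectory_set s0 T" "S0 \<in> T"
    and pos: "\<And>n S. S \<in> T \<Longrightarrow> 0 \<le> g n S"
    and dom: "\<And>S. S \<in> T \<Longrightarrow> f S \<le> (\<Sum>n. g n S)"
  shows "upper_I0 T f \<le> (\<Sum>n. upper_I0 T (g n))"
proof (cases "\<exists>n. upper_I0 T (g n) = \<infinity>")
  case True
  then have "(\<Sum>n. upper_I0 T (g n)) = \<infinity>"
    using suminf_PInfty[of "\<lambda>n. upper_I0 T (g n)"] upper_I0_nonneg[OF T] by blast
  then show ?thesis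
    by simp
next
  case False
  have "upper_I0 T f \<le> (\<Sum>n. upper_I0 T (g n)) + ereal e" if "e > 0" for e
  proof -
    define Q where "Q n V H \<longleftrightarrow> (\<forall>m. nonneg_portfolio T S0 0 (V m) (H m)) \<and>
        (\<forall>S\<in>T. g n S \<le> (\<Sum>m. liminf_portfolio (V m) (H m) 0 S)) \<and>
        (\<Sum>m. ereal (V m)) < upper_I0 T (g n) + ereal (e * (1/2) ^ Suc n)" for n V H
    have "\<exists>V H. Q n V H" for n
    proof -
      \<comment> \<open>Finiteness of the value makes the added error a strict increase, so a
        near-optimal superhedge exists.\<close>
      have "upper_I0 T (g n) < upper_I0 T (g n) + ereal (e * (1/2) ^ Suc n)"
        using False upper_I0_nonneg[OF T, of "g n"] \<open>e > 0\<close>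
        by (cases "upper_I0 T (g n)") auto
      then show ?thesis
        unfolding Q_def by (rule upper_I0_lessE[OF T]) blast
    qed
    then obtain V H where "Q n (V n) (H n)" for n
      by metis
    then have nn: "\<And>n m. nonneg_portfolio T S0 0 (V n m) (H n m)"
      and hedge: "\<And>n S. S \<in> T \<Longrightarrow> g n S \<le> (\<Sum>m. liminf_portfolio (V n m) (H n m) 0 S)"
      and cost: "\<And>n. (\<Sum>m. ereal (V n m)) < upper_I0 T (g n) + ereal (e * (1/2) ^ Suc n)"
      unfolding Q_def by blast+
    define V' where "V' k = (case prod_decode k of (n, m) \<Rightarrow> V n m)" for k
    define H' where "H' k = (case prod_decode k of (n, m) \<Rightarrow> H n m)" for k
    have nn': "nonneg_portfolio T S0 0 (V' k) (H' k)" for k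
      by (simp add: V'_def H'_def case_prod_beta nn)
    have "upper_I0 T f \<le> (\<Sum>k. ereal (V' k))"
    proof (rule upper_I0_le[OF T nn'])
      fix S
      assume S: "S \<in> T"
      have "f S \<le> (\<Sum>n. g n S)"
        by (rule dom[OF S])
      also have "\<dots> \<le> (\<Sum>n. \<Sum>m. liminf_portfolio (V n m) (H n m) 0 S)"
        by (intro suminf_le_pos hedge[OF S] pos[OF S])
      also have "\<dots> = (\<Sum>k. (\<lambda>(n, m). liminf_portfolio (V n m) (H n m) 0 S) (prod_decode k))"
        using nonneg_portfolio_liminf[OF nn] S node_0[OF T]
        by (subst suminf_ereal_prod_decode) auto
      also have "\<dots> = (\<Sum>k. liminf_portfolio (V' k) (H' k) 0 S)"
        by (simp add: V'_def H'_def case_prod_beta)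
      finally show "f S \<le> (\<Sum>k. liminf_portfolio (V' k) (H' k) 0 S)" .
    qed
    also have "(\<Sum>k. ereal (V' k)) = (\<Sum>k. (\<lambda>(n, m). ereal (V n m)) (prod_decode k))"
      by (simp add: V'_def case_prod_beta)
    also have "\<dots> = (\<Sum>n. \<Sum>m. ereal (V n m))"
      using nonneg_portfolio_initial[OF nn T(2)] by (subst suminf_ereal_prod_decode) auto
    also have "\<dots> \<le> (\<Sum>n. upper_I0 T (g n) + ereal (e * (1/2) ^ Suc n))"
      using nonneg_portfolio_initial[OF nn T(2)]
      by (intro suminf_le_pos less_imp_le[OF cost] suminf_0_le) auto
    also have "\<dots> = (\<Sum>n. upper_I0 T (g n)) + (\<Sum>n. ereal (e * (1/2) ^ Suc n))"
      using \<open>e > 0\<close> by (intro suminf_add_ereal upper_I0_nonneg[OF T]) auto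
    also have "(\<Sum>n. ereal (e * (1/2) ^ Suc n)) = ereal e"
      using sums_mult[OF power_half_series, of e] by (intro sums_suminf_ereal) simp
    finally show ?thesis .
  qed
  then show ?thesis
    by (rule ereal_le_epsilon2)
qed

subsection \<open>Null sets\<close>

text \<open>For empty \<open>T\<close> the constraints on superhedges are vacuous and cost
  \<open>- 1\<close> is admissible, so no set would be null. This supplies a base path wherever a
  null set is given.\<close>

lemma null_set_nonempty:
  assumes "null_set T E"
  shows "T \<noteq> {}"
proof
  assume "T = {}"
  then have "upper_I0 T (indicator E) \<le> (\<Sum>m. ereal (if m = (0::nat) then - 1 else 0))"
    unfolding upper_I0_def upper_I_def
    by (intro Inf_lower) (auto simp: nonneg_portfolio_def node_def hedges_def intro!: exI)
  also have "\<dots> = - 1"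
    by (subst suminf_finite[of "{0}"]) (auto simp: zero_ereal_def one_ereal_def)
  finally show False
    using assms by (simp add: null_set_def)
qed

lemma null_set_UN:
  assumes T: "trajectory_set s0 T" and "\<And>n::nat. null_set T (E n)"
  shows "null_set T (\<Union>n. E n)"
proof -
  obtain S0 where S0: "S0 \<in> T"
    using null_set_nonempty[OF assms(2)] by blast
  have "upper_I0 T (indicator (\<Union>n. E n)) \<le> (\<Sum>n. upper_I0 T (indicator (E n)))"
  proof (rule upper_I0_le_suminf[OF T S0])
    fix S
    show "indicator (\<Union>n. E n) S \<le> (\<Sum>n. indicator (E n) S :: ereal)"
    proof (cases "S \<in> (\<Union>n. E n)")
      case True
      then obtain n where "S \<in> E n"
        by blast
      then have "indicator (\<Union>n. E n) S = (\<Sum>i\<in>{n}. indicator (E i) S :: ereal)"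
        by (auto simp: indicator_def)
      also have "\<dots> \<le> (\<Sum>n. indicator (E n) S)"
        by (intro sum_le_suminf) (auto intro: summable_ereal_pos)
      finally show ?thesis .
    qed (auto intro: suminf_0_le)
  qed simp
  also have "\<dots> = 0"
    using assms(2) by (simp add: null_set_def)
  finally show ?thesis
    using assms(2) upper_I0_nonneg[OF T S0, of "indicator (\<Union>n. E n)"] by (auto simp: null_set_def)
qed

lemma null_set_Un:
  assumes "trajectory_set s0 T" "null_set T A" "null_set T B"
  shows "null_set T (A \<union> B)"
proof -
  have "A \<union> B = (\<Union>n::nat. if n = 0 then A else B)"
    by (auto split: if_splits intro: exI[of _ 0] exI[of _ 1])
  then show ?thesis
    using null_set_UN[OF assms(1), of "\<lambda>n. if n = 0 then A else B"] assms(2,3) by simp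
qed

text \<open>Subadditivity for the cover of \<open>A\<close> by \<open>A - E\<close> and
  \<open>E\<close>, the second part contributing \<open>0\<close>.\<close>

lemma upper_I0_Diff_null:
  assumes T: "trajectory_set s0 T" and E: "null_set T E"
  shows "upper_I0 T (indicator A) \<le> upper_I0 T (indicator (A - E))"
proof -
  obtain S0 where S0: "S0 \<in> T"
    using null_set_nonempty[OF E] by blast
  define F where "F n = (if n = (0::nat) then A - E else E)" for n
  have "upper_I0 T (indicator A) \<le> (\<Sum>n. upper_I0 T (indicator (F n)))"
  proof (rule upper_I0_le_suminf[OF T S0])
    fix S
    have "indicator A S \<le> (\<Sum>n\<in>{0,1}. indicator (F n) S :: ereal)"
      by (auto simp: F_def indicator_def)
    also have "\<dots> \<le> (\<Sum>n. indicator (F n) S)"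
      by (intro sum_le_suminf) (auto intro: summable_ereal_pos)
    finally show "indicator A S \<le> (\<Sum>n. indicator (F n) S :: ereal)" .
  qed simp
  also have "\<dots> = (\<Sum>n\<in>{0}. upper_I0 T (indicator (F n)))"
    using E by (intro suminf_finite) (auto simp: F_def null_set_def)
  finally show ?thesis
    by (simp add: F_def)
qed

text \<open>Holding capital \<open>1\<close> without trading superhedges every indicator.\<close>

lemma upper_I0_indicator_le_1:
  assumes T: "trajectory_set s0 T" "S0 \<in> T"
  shows "upper_I0 T (indicator A) \<le> 1"
proof -
  define V where "V m = (if m = (0::nat) then 1 else 0 :: real)" for m
  have sum: "(\<Sum>m. ereal (V m)) = 1"
    by (subst suminf_finite[of "{0}"]) (auto simp: V_def zero_ereal_def one_ereal_def)
  have "upper_I0 T (indicator A) \<le> (\<Sum>m. ereal (V m))"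
  proof (rule upper_I0_le[OF T])
    show "nonneg_portfolio T S0 0 (V m) (\<lambda>_ _. 0)" for m
      by (simp add: nonneg_portfolio_def hedges_def portfolio_def V_def)
    show "indicator A S \<le> (\<Sum>m. liminf_portfolio (V m) (\<lambda>_ _. 0) 0 S)" for S
      by (simp add: liminf_portfolio_def portfolio_def Liminf_const sum indicator_def)
  qed
  then show ?thesis
    by (simp add: sum)
qed

text \<open>
  Moves at a node that is not up-down all have the same sign, so betting on that sign costs nothing;
  countably many copies of the bet pay off infinitely much.
\<close>

lemma null_set_arbitrage:
  assumes T: "trajectory_set s0 T" "T \<noteq> {}"
  shows "null_set T {S \<in> T. \<exists>j. \<not> up_down_node T S j \<and> S (Suc j) \<noteq> S j}"
    (is "null_set T ?A")
proof -
  obtain S0 where S0: "S0 \<in> T"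
    using T(2) by blast
  define G where "G j S = (if up_down_node T S j then 0
    else if \<exists>S'\<in>node T S j. S j < S' (Suc j) then 1 else - 1 :: real)" for j S
  have G: "G j S * (S (Suc j) - S j) = (if up_down_node T S j then 0 else \<bar>S (Suc j) - S j\<bar>)"
    if "S \<in> T" for S j
    using node_self[OF that, of j] unfolding G_def up_down_node_def by fastforce
  then have portfolio: "portfolio 0 G 0 n S =
      (\<Sum>i<n. if up_down_node T S i then 0 else \<bar>S (Suc i) - S i\<bar>)" if "S \<in> T" for n S
    using that by (simp add: portfolio_def atLeast0LessThan)
  have hedges: "G \<in> hedges T S0 0"
  proof (rule hedgesI)
    fix i S1 S2
    assume "S1 \<in> node T S0 0" "S2 \<in> node T S0 0" and eq: "\<And>k. 0 \<le> k \<Longrightarrow> k \<le> i \<Longrightarrow> S1 k = S2 k"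
    then have "node T S1 i = node T S2 i"
      by (simp add: node_def)
    with eq[of i] show "G i S1 = G i S2"
      by (simp add: G_def up_down_node_def)
  qed
  have nn: "nonneg_portfolio T S0 0 0 G"
    using hedges by (auto simp: nonneg_portfolio_0_iff[OF T(1) S0] portfolio intro!: sum_nonneg)
  have "upper_I0 T (indicator ?A) \<le> (\<Sum>m::nat. ereal 0)"
  proof (rule upper_I0_le[OF T(1) S0 nn])
    fix S
    assume S: "S \<in> T"
    have lim_pos: "0 \<le> liminf_portfolio 0 G 0 S"
      using nonneg_portfolio_liminf[OF nn] S node_0[OF T(1) S0] by blast
    show "indicator ?A S \<le> (\<Sum>m::nat. liminf_portfolio 0 G 0 S)"
    proof (cases "S \<in> ?A")
      case True
      then obtain j where j: "\<not> up_down_node T S j" "S (Suc j) \<noteq> S j"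
        by blast
      define d where "d = \<bar>S (Suc j) - S j\<bar>"
      have d: "d > 0"
        using j by (simp add: d_def)
      have "ereal d \<le> liminf_portfolio 0 G 0 S"
      proof (rule liminf_portfolio_ge)
        fix n
        assume "Suc j \<le> n"
        then have "(\<Sum>i\<in>{j}. if up_down_node T S i then 0 else \<bar>S (Suc i) - S i\<bar>) \<le> portfolio 0 G 0 n S"
          unfolding portfolio[OF S] by (intro sum_mono2) auto
        then show "d \<le> portfolio 0 G 0 n S"
          using j by (simp add: d_def)
      qed
      note d_le = this
      \<comment> \<open>The gain \<open>d\<close> depends on the path, and so does the number of
        copies needed to reach \<open>1\<close>; the countable family serves all paths at
        once.\<close>
      obtain n :: nat where n: "1 / d \<le> real n"
        using real_arch_simple by blast
      have "ereal 1 \<le> (\<Sum>m<n. ereal d)"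
        using n d by (simp add: field_simps)
      also have "\<dots> \<le> (\<Sum>m<n. liminf_portfolio 0 G 0 S)"
        by (intro sum_mono d_le)
      also have "\<dots> \<le> (\<Sum>m::nat. liminf_portfolio 0 G 0 S)"
        using lim_pos by (intro sum_le_suminf) (auto simp: summable_ereal_pos)
      finally show ?thesis
        using True by (simp add: one_ereal_def)
    qed (auto intro: suminf_0_le lim_pos)
  qed
  then show ?thesis
    using upper_I0_nonneg[OF T(1) S0, of "indicator ?A"] by (simp add: null_set_def flip: zero_ereal_def)
qed

subsection \<open>Superhedging between stopping times\<close>

text \<open>In place of a filtration, the event that \<open>\<rho>\<close> has occurred by time
  \<open>j\<close> is required to be constant on nodes at time \<open>j\<close>.\<close>

definition stopping_time :: "traj set \<Rightarrow> (traj \<Rightarrow> enat) \<Rightarrow> bool" where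
  "stopping_time T \<rho> \<longleftrightarrow>
     (\<forall>j. \<forall>S\<in>T. \<forall>S'\<in>node T S j. \<rho> S' \<le> enat j \<longleftrightarrow> \<rho> S \<le> enat j)"

lemma stopping_timeD:
  "stopping_time T \<rho> \<Longrightarrow> S \<in> T \<Longrightarrow> S' \<in> node T S j \<Longrightarrow> \<rho> S' \<le> enat j \<longleftrightarrow> \<rho> S \<le> enat j"
  by (simp add: stopping_time_def)

lemma stopping_time_eq:
  assumes \<rho>: "stopping_time T \<rho>" and S: "S \<in> T" "S' \<in> node T S j" and le: "\<rho> S \<le> enat j"
  shows "\<rho> S' = \<rho> S"
proof -
  obtain r where r: "\<rho> S = enat r" "r \<le> j"
    using le by (cases "\<rho> S") auto
  obtain r' where r': "\<rho> S' = enat r'" "r' \<le> j"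
    using stopping_timeD[OF \<rho> S] le by (cases "\<rho> S'") auto
  \<comment> \<open>Testing at time \<open>r\<close> gives \<open>r' \<le> r\<close>, and testing at
    time \<open>r'\<close> gives the converse.\<close>
  have "S' \<in> node T S r" "S' \<in> node T S r'"
    using S(2) r(2) r'(2) by (auto simp: node_def)
  from this[THEN stopping_timeD[OF \<rho> S(1)]] show ?thesis
    unfolding r(1) r'(1) by simp
qed

lemma portfolio_const:
  assumes "\<And>i. i < n \<Longrightarrow> H i S = 0"
  shows "portfolio V H 0 n S = V"
  using assms by (simp add: portfolio_def)

text \<open>
  Each portfolio of a superhedge of \<open>{\<rho> < \<infinity>}\<close> is held until \<open>\<rho>\<close>, and its value at that time is then
  invested in \<open>G\<close>; property (L) at time \<open>\<rho>\<close> says that these values add up to at least \<open>1\<close>.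
\<close>

lemma upper_I0_stopped_le:
  assumes T: "trajectory_set s0 T" "S0 \<in> T" and \<rho>: "stopping_time T \<rho>"
    and G: "G \<in> hedges T S0 0" and "c > 0"
    and G0: "\<And>S i. S \<in> T \<Longrightarrow> enat i < \<rho> S \<Longrightarrow> G i S = 0"
    and G_nonneg: "\<And>S n. S \<in> T \<Longrightarrow> 0 \<le> portfolio c G 0 n S"
    and A: "\<And>S. S \<in> A \<Longrightarrow> S \<in> T \<and> \<rho> S < \<infinity> \<and> prop_L T S (the_enat (\<rho> S)) \<and>
      (\<exists>N. \<forall>n\<ge>N. 1 \<le> portfolio c G 0 n S)"
  shows "upper_I0 T (indicator A) \<le> ereal c * upper_I0 T (indicator {S \<in> T. \<rho> S < \<infinity>})"
    (is "?I1 \<le> _ * ?I2")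
proof -
  have bound: "?I1 \<le> ereal c * (\<Sum>m. ereal (V m))"
    if nn: "\<And>m. nonneg_portfolio T S0 0 (V m) (H m)"
      and hedge: "\<And>S. S \<in> T \<Longrightarrow>
        indicator {S \<in> T. \<rho> S < \<infinity>} S \<le> (\<Sum>m. liminf_portfolio (V m) (H m) 0 S)" for V H
  proof -
    define W where "W m S = portfolio (V m) (H m) 0 (the_enat (\<rho> S)) S" for m S
    define H' where "H' m i S = (if \<rho> S \<le> enat i then W m S * G i S else c * H m i S)" for m i S
    have W_nonneg: "0 \<le> W m S" if "S \<in> T" for m S
      using nn[of m] that unfolding W_def nonneg_portfolio_0_iff[OF T] by blast
    have Hm: "H m \<in> hedges T S0 0" for m
      using nn[of m] by (simp add: nonneg_portfolio_def)
    \<comment> \<open>The wealth factors into the \<open>m\<close>-th portfolio stopped at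
      \<open>\<rho>\<close> and the wealth of \<open>G\<close>, which still equals \<open>c\<close>
      up to \<open>\<rho>\<close>. Non-negativity follows from the two factors.\<close>
    have port: "portfolio (c * V m) (H' m) 0 n S =
        (if \<rho> S \<le> enat n then W m S else portfolio (V m) (H m) 0 n S) * portfolio c G 0 n S"
      if S: "S \<in> T" for m n S
    proof (induction n)
      case 0
      have "the_enat 0 = 0"
        by (metis the_enat.simps zero_enat_def)
      then show ?case
        by (auto simp: W_def zero_enat_def[symmetric])
    next
      case (Suc n)
      show ?case
      proof (cases "\<rho> S \<le> enat n")
        case True
        then have "\<rho> S \<le> enat (Suc n)"
          by (meson enat_ord_simps(1) le_SucI order_refl order_trans)
        with True Suc show ?thesis
          by (simp add: portfolio_Suc H'_def algebra_simps)
      next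
        case False
        have "G i S = 0" if "i \<le> n" for i
          using False that by (intro G0[OF S] le_less_trans[of "enat i" "enat n"]) auto
        then have c: "portfolio c G 0 n S = c" "portfolio c G 0 (Suc n) S = c"
          by (auto intro!: portfolio_const)
        have "W m S = portfolio (V m) (H m) 0 (Suc n) S" if "\<rho> S \<le> enat (Suc n)"
          using that False by (cases "\<rho> S") (auto simp: W_def le_Suc_eq)
        then have stopped: "(if \<rho> S \<le> enat (Suc n) then W m S else portfolio (V m) (H m) 0 (Suc n) S)
            = portfolio (V m) (H m) 0 (Suc n) S"
          by simp
        show ?thesis
          unfolding stopped using False Suc by (simp add: c portfolio_Suc H'_def algebra_simps)
      qed
    qed
    have hedges: "H' m \<in> hedges T S0 0" for m
    proof (rule hedgesI)
      fix i S1 S2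
      assume S12: "S1 \<in> node T S0 0" "S2 \<in> node T S0 0"
        and eq: "\<And>k. 0 \<le> k \<Longrightarrow> k \<le> i \<Longrightarrow> S1 k = S2 k"
      have S: "S1 \<in> T" "S2 \<in> T"
        using S12 nodeD by blast+
      have S2: "S2 \<in> node T S1 i"
        using eq S by (simp add: node_def)
      have "G i S1 = G i S2" "H m i S1 = H m i S2"
        by (intro hedgesD[OF G _ S12] hedgesD[OF Hm _ S12] eq; simp)+
      moreover have "W m S1 = W m S2" if le: "\<rho> S1 \<le> enat i"
      proof -
        have \<rho>_eq: "\<rho> S2 = \<rho> S1"
          by (rule stopping_time_eq[OF \<rho> S(1) S2 le])
        obtain r where r: "\<rho> S1 = enat r" "r \<le> i"
          using le by (cases "\<rho> S1") auto
        have "S2 \<in> node T S1 r"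
          using S2 r(2) by (simp add: node_def)
        from portfolio_continue[OF Hm S12(1) _ _ this, of r "V m" m] show ?thesis
          by (simp add: W_def \<rho>_eq r(1))
      qed
      ultimately show "H' m i S1 = H' m i S2"
        using stopping_timeD[OF \<rho> S(1) S2] by (simp add: H'_def)
    qed
    have nn': "nonneg_portfolio T S0 0 (c * V m) (H' m)" for m
      unfolding nonneg_portfolio_0_iff[OF T]
    proof (intro conjI hedges allI ballI)
      fix n S
      assume S: "S \<in> T"
      show "0 \<le> portfolio (c * V m) (H' m) 0 n S"
        unfolding port[OF S] using W_nonneg[OF S] G_nonneg[OF S] nn S
        by (simp add: nonneg_portfolio_0_iff[OF T])
    qed
    have "?I1 \<le> (\<Sum>m. ereal (c * V m))"
    proof (rule upper_I0_le[OF T nn'])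
      fix S
      assume S: "S \<in> T"
      have lim_pos: "0 \<le> liminf_portfolio (c * V m) (H' m) 0 S" for m
        using nonneg_portfolio_liminf[OF nn'] S node_0[OF T] by blast
      show "indicator A S \<le> (\<Sum>m. liminf_portfolio (c * V m) (H' m) 0 S)"
      proof (cases "S \<in> A")
        case True
        obtain r where r: "\<rho> S = enat r"
          using A[OF True] by (cases "\<rho> S") auto
        have S_node: "S \<in> node T S0 0"
          using S node_0[OF T] by blast
        obtain N where N: "\<And>n. n \<ge> N \<Longrightarrow> 1 \<le> portfolio c G 0 n S"
          using A[OF True] by blast
        \<comment> \<open>The finite-horizon portfolio is zero here: the indicator is
          \<open>1\<close> on the whole node at time \<open>\<rho>\<close>, so (L) there makes the
          values at \<open>\<rho>\<close> total at least \<open>1\<close>.\<close>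
        have "ereal (1 - portfolio 0 (\<lambda>_ _. 0) 0 r S) \<le> (\<Sum>m. ereal (portfolio (V m) (H m) 0 r S))"
        proof (rule prop_L_dominate[OF _ _ _ nn S_node])
          show "(\<lambda>_ _. 0) \<in> hedges T S0 0"
            by (rule hedgesI) simp
          show "prop_L T S r"
            using A[OF True] r by simp
          fix S''
          assume S'': "S'' \<in> node T S r"
          have "\<rho> S'' = enat r"
            using stopping_time_eq[OF \<rho> S S''] r by simp
          then show "ereal 1 \<le> ereal (portfolio 0 (\<lambda>_ _. 0) 0 r S'') +
              (\<Sum>m. liminf_portfolio (V m) (H m) 0 S'')"
            using hedge[of S''] nodeD(1)[OF S''] by (simp add: portfolio_def one_ereal_def zero_ereal_def[symmetric])
        qed auto
        then have "1 \<le> (\<Sum>m. ereal (W m S))"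
          by (simp add: W_def r portfolio_def one_ereal_def)
        also have "\<dots> \<le> (\<Sum>m. liminf_portfolio (c * V m) (H' m) 0 S)"
        proof (intro suminf_le_pos liminf_portfolio_ge)
          fix m n
          assume n: "max N r \<le> n"
          then have "1 \<le> portfolio c G 0 n S"
            using N by simp
          then have "W m S * 1 \<le> W m S * portfolio c G 0 n S"
            by (intro mult_left_mono W_nonneg[OF S])
          then show "W m S \<le> portfolio (c * V m) (H' m) 0 n S"
            using n r by (simp add: port[OF S])
        qed (simp add: W_nonneg[OF S])
        finally show ?thesis
          using True by simp
      qed (auto intro: suminf_0_le lim_pos)
    qed
    also have "(\<Sum>m. ereal (c * V m)) = (\<Sum>m. ereal c * ereal (V m))"
      by simp
    also have "\<dots> = ereal c * (\<Sum>m. ereal (V m))"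
      using nonneg_portfolio_initial[OF nn T(2)] \<open>c > 0\<close> by (intro suminf_cmult_ereal) auto
    finally show ?thesis .
  qed
  obtain r where r: "?I1 = ereal r"
    using upper_I0_nonneg[OF T, of "indicator A"] upper_I0_indicator_le_1[OF T, of A]
    by (cases ?I1) (auto simp: one_ereal_def)
  obtain s where s: "?I2 = ereal s"
    using upper_I0_nonneg[OF T, of "indicator {S \<in> T. \<rho> S < \<infinity>}"]
      upper_I0_indicator_le_1[OF T, of "{S \<in> T. \<rho> S < \<infinity>}"]
    by (cases ?I2) (auto simp: one_ereal_def)
  show ?thesis
  proof (rule ccontr)
    assume "\<not> ?thesis"
    \<comment> \<open>If the estimate failed, some superhedge would cost less than
      \<open>r / c\<close>, contradicting \<open>bound\<close>.\<close>
    then have "?I2 < ereal (r / c)"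
      using \<open>c > 0\<close> unfolding r s by (simp add: field_simps)
    then obtain V H where "\<And>m. nonneg_portfolio T S0 0 (V m) (H m)"
      "\<And>S. S \<in> T \<Longrightarrow> indicator {S \<in> T. \<rho> S < \<infinity>} S \<le> (\<Sum>m. liminf_portfolio (V m) (H m) 0 S)"
      and less: "(\<Sum>m. ereal (V m)) < ereal (r / c)"
      using upper_I0_lessE[OF T] by blast
    then have "ereal r \<le> ereal c * (\<Sum>m. ereal (V m))"
      using bound[of V H] r by simp
    with less show False
      using \<open>c > 0\<close> by (cases "\<Sum>m. ereal (V m)") (auto simp: field_simps)
  qed
qed

section \<open>Hedging a supermartingale with wealth-dependent positions\<close>

primrec feedback_wealth :: "real \<Rightarrow> (nat \<Rightarrow> traj \<Rightarrow> real \<Rightarrow> real) \<Rightarrow> nat \<Rightarrow> traj \<Rightarrow> real" where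
  "feedback_wealth c g 0 S = c"
| "feedback_wealth c g (Suc n) S =
     feedback_wealth c g n S + g n S (feedback_wealth c g n S) * (S (Suc n) - S n)"

text \<open>The position depends on the wealth reached so far, so the wealth is defined by recursion
  first; this identity turns it into an ordinary portfolio.\<close>

lemma feedback_wealth_eq_portfolio:
  "feedback_wealth c g n S = portfolio c (\<lambda>i S. g i S (feedback_wealth c g i S)) 0 n S"
  by (induction n) (simp_all add: portfolio_Suc)

text \<open>Paths along which the step-by-step hedge succeeds at every time;
  \<open>null_set_not_regular\<close> confines all others to a null set.\<close>

definition regular :: "traj set \<Rightarrow> (nat \<Rightarrow> traj \<Rightarrow> real) \<Rightarrow> traj \<Rightarrow> bool" where
  "regular T f S \<longleftrightarrow> (\<forall>j. prop_L T S j \<and>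
     upper_sigma T j (\<lambda>S. ereal (f (Suc j) S)) S \<le> ereal (f j S) \<and>
     (up_down_node T S j \<or> S (Suc j) = S j))"

text \<open>On a regular path the wealth between \<open>\<rho>\<close> and \<open>\<tau>\<close>
  stays at least \<open>f n S + e / 2 ^ n\<close>: half of the surplus pays for the error of the
  next step, the other half is carried on.\<close>

lemma supermartingale_hedge:
  assumes T: "trajectory_set s0 T" "S0 \<in> T" and P: "prop_P T"
    and na: "\<And>j S S'. S \<in> T \<Longrightarrow> S' \<in> node T S j \<Longrightarrow> f j S' = f j S"
    and nonneg: "\<And>j S. S \<in> T \<Longrightarrow> 0 \<le> f j S"
    and \<rho>: "stopping_time T \<rho>" and \<tau>: "stopping_time T \<tau>"
    and a: "\<And>S n. S \<in> T \<Longrightarrow> \<rho> S = enat n \<Longrightarrow> f n S \<le> a"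
    and "0 \<le> a" "e > 0"
  obtains G where "G \<in> hedges T S0 0"
    "\<And>S i. S \<in> T \<Longrightarrow> enat i < \<rho> S \<or> \<tau> S \<le> enat i \<Longrightarrow> G i S = 0"
    "\<And>S n. S \<in> T \<Longrightarrow> 0 \<le> portfolio (a + e) G 0 n S"
    "\<And>S n. S \<in> T \<Longrightarrow> regular T f S \<Longrightarrow> \<rho> S \<le> enat n \<Longrightarrow> enat n \<le> \<tau> S \<Longrightarrow>
       f n S \<le> portfolio (a + e) G 0 n S"
proof -
  define Q where "Q n S h \<longleftrightarrow> (\<forall>S'\<in>node T S n.
      0 \<le> f n S + e / 2 ^ Suc n + h * (S' (Suc n) - S n) \<and>
      (prop_L T S' (Suc n) \<longrightarrow> f (Suc n) S' \<le> f n S + e / 2 ^ Suc n + h * (S' (Suc n) - S n)))"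
    for n S h
  define hh where "hh n S = (if \<exists>h. Q n S h then SOME h. Q n S h else 0)" for n S
  have hh: "Q n S (hh n S)" if "Q n S h" for n S h
    using that someI[of "Q n S"] by (auto simp: hh_def)
  \<comment> \<open>Equality of the predicates, so that \<open>SOME\<close> picks the same position
    throughout a node and the strategy is non-anticipative.\<close>
  have Q_cong: "Q n S' = Q n S" if "S \<in> T" "S' \<in> node T S n" for n S S'
    using na[OF that] node_eq[OF that(2)] nodeD(2)[OF that(2), of n] by (simp add: Q_def fun_eq_iff)
  \<comment> \<open>The condition on \<open>u\<close> keeps the wealth non-negative even after passing an irregular node.\<close>
  define g where "g n S u = (if \<rho> S \<le> enat n \<and> \<not> \<tau> S \<le> enat n \<and> f n S + e / 2 ^ n \<le> u \<and> (\<exists>h. Q n S h)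
      then hh n S else 0)" for n S u
  have g_cong: "g n S' = g n S" if "S \<in> T" "S' \<in> node T S n" for n S S'
    using stopping_timeD[OF \<rho> that] stopping_timeD[OF \<tau> that] na[OF that] Q_cong[OF that]
    unfolding g_def hh_def by (intro ext) auto
  define W where "W = feedback_wealth (a + e) g"
  define G where "G i S = g i S (W i S)" for i S
  have W_Suc: "W (Suc n) S = W n S + G n S * (S (Suc n) - S n)" for n S
    by (simp add: W_def G_def)
  have W_0: "W 0 S = a + e" for S
    by (simp add: W_def)
  have W: "portfolio (a + e) G 0 n S = W n S" for n S
    unfolding W_def G_def[abs_def] by (rule feedback_wealth_eq_portfolio[symmetric])
  have half: "e / 2 ^ n = e / 2 ^ Suc n + e / 2 ^ Suc n" for n
    by simp
  have half_pos: "0 < e / 2 ^ n" for n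
    using \<open>e > 0\<close> by simp
  show ?thesis
  proof (rule that[of G])
    show "G \<in> hedges T S0 0"
    proof (rule hedgesI)
      fix i S1 S2
      assume S12: "S1 \<in> node T S0 0" "S2 \<in> node T S0 0"
        and eq: "\<And>k. 0 \<le> k \<Longrightarrow> k \<le> i \<Longrightarrow> S1 k = S2 k"
      have S: "S1 \<in> T" "S2 \<in> T"
        using S12 nodeD by blast+
      have "S2 \<in> node T S1 n" if "n \<le> i" for n
        using eq S that by (simp add: node_def)
      then have g12: "g n S2 = g n S1" if "n \<le> i" for n
        using g_cong[OF S(1)] that by blast
      have "W n S2 = W n S1" if "n \<le> i" for n
        using that
      proof (induction n)
        case (Suc n)
        then show ?case
          using eq[of n] eq[of "Suc n"] g12[of n] by (simp add: W_Suc G_def)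
      qed (simp add: W_0)
      then show "G i S1 = G i S2"
        using g12 by (simp add: G_def)
    qed
  next
    fix S i
    assume "S \<in> T" "enat i < \<rho> S \<or> \<tau> S \<le> enat i"
    then show "G i S = 0"
      by (auto simp: G_def g_def not_le)
  next
    fix S n
    assume S: "S \<in> T"
    show "0 \<le> portfolio (a + e) G 0 n S"
      unfolding W
    proof (induction n)
      case 0
      then show ?case
        using \<open>0 \<le> a\<close> \<open>e > 0\<close> by (simp add: W_0)
    next
      case (Suc n)
      show ?case
      proof (cases "G n S = 0")
        case False
        then have *: "f n S + e / 2 ^ n \<le> W n S" "\<exists>h. Q n S h" "G n S = hh n S"
          by (auto simp: G_def g_def split: if_splits)
        then have "Q n S (hh n S)"
          using hh by blast
        then have "0 \<le> f n S + e / 2 ^ Suc n + hh n S * (S (Suc n) - S n)"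
          using node_self[OF S, of n] by (auto simp: Q_def)
        then show ?thesis
          using *(1) half[of n] half_pos[of "Suc n"] unfolding W_Suc *(3) by linarith
      qed (use Suc in \<open>simp add: W_Suc\<close>)
    qed
  next
    fix S n
    assume S: "S \<in> T" and reg: "regular T f S" and "\<rho> S \<le> enat n" "enat n \<le> \<tau> S"
    have W_early: "W n S = a + e" if "enat n \<le> \<rho> S" for n
    proof -
      have "G i S = 0" if "i < n" for i
      proof -
        have "enat i < \<rho> S"
          using \<open>i < n\<close> \<open>enat n \<le> \<rho> S\<close> by (meson enat_ord_simps(2) less_le_trans)
        then show ?thesis
          by (auto simp: G_def g_def not_le)
      qed
      then show ?thesis
        by (simp add: portfolio_const flip: W)
    qed
    have start: "f n S + e / 2 ^ n \<le> W n S" if "\<rho> S = enat n" for n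
    proof -
      have "e / 2 ^ n \<le> e"
        using \<open>e > 0\<close> by (simp add: field_simps)
      then show ?thesis
        using a[OF S that] W_early[of n] that by simp
    qed
    \<comment> \<open>The claim is strengthened by the surplus \<open>e / 2 ^ n\<close>, which is
      also the wealth condition under which \<open>g\<close> trades.\<close>
    have "f n S + e / 2 ^ n \<le> W n S"
      using \<open>\<rho> S \<le> enat n\<close> \<open>enat n \<le> \<tau> S\<close>
    proof (induction n)
      case 0
      then show ?case
        using start[of 0] by (simp add: zero_enat_def[symmetric])
    next
      case (Suc n)
      show ?case
      proof (cases "\<rho> S \<le> enat n")
        case False
        then have "\<rho> S = enat (Suc n)"
          using Suc.prems(1) by (cases "\<rho> S") auto
        then show ?thesis
          by (rule start)
      next
        case True
        have "\<not> \<tau> S \<le> enat n" "enat n \<le> \<tau> S"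
          using Suc.prems(2) by (cases "\<tau> S"; simp)+
        then have IH: "f n S + e / 2 ^ n \<le> W n S"
          using Suc.IH True by blast
        have sigma: "upper_sigma T n (\<lambda>S. ereal (f (Suc n) S)) S < ereal (f n S + e / 2 ^ Suc n)"
        proof (rule le_less_trans)
          show "upper_sigma T n (\<lambda>S. ereal (f (Suc n) S)) S \<le> ereal (f n S)"
            using reg by (simp add: regular_def)
        qed (use half_pos[of "Suc n"] in simp)
        have L: "prop_L T S n" "prop_L T S (Suc n)"
          using reg by (simp_all add: regular_def)
        have "f (Suc n) S \<le> f n S + e / 2 ^ Suc n + G n S * (S (Suc n) - S n)"
        proof (cases "up_down_node T S n")
          case True
          have ex: "\<exists>h. Q n S h"
            unfolding Q_def by (rule up_down_step_hedge[OF S sigma na nonneg P L(1) True])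
          then have "G n S = hh n S"
            using \<open>\<rho> S \<le> enat n\<close> \<open>\<not> \<tau> S \<le> enat n\<close> IH by (simp add: G_def g_def)
          then show ?thesis
            using hh ex L(2) node_self[OF S, of n] unfolding Q_def by metis
        next
          case False
          \<comment> \<open>Regularity excludes a move at this node, so whatever position is held
            earns nothing.\<close>
          then have flat: "S (Suc n) = S n"
            using reg by (auto simp: regular_def)
          then show ?thesis
            using flat_step_bound[OF S sigma na L(2) flat] by simp
        qed
        then show ?thesis
          using IH half[of n] unfolding W_Suc by linarith
      qed
    qed
    then show "f n S \<le> portfolio (a + e) G 0 n S"
      unfolding W using half_pos[of n] by linarith
  qed
qed

subsection \<open>Upcrossings\<close>

text \<open>The order on \<open>enat\<close> is well-founded, so the infimum of a non-empty set is
  attained; a finite bound excludes the empty set, whose infimum is infinite.\<close>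

lemma Inf_enat_le_iff: "Inf {enat n | n. R n} \<le> enat j \<longleftrightarrow> (\<exists>n\<le>j. R n)"
proof
  assume le: "Inf {enat n | n. R n} \<le> enat j"
  then have "{enat n | n. R n} \<noteq> {}"
    by (auto simp: Inf_enat_def simp del: Collect_empty_eq)
  then obtain m where "R m"
    by blast
  then have "Inf {enat n | n. R n} \<in> {enat n | n. R n}"
    by (intro wellorder_InfI[of "enat m"]) blast
  with le show "\<exists>n\<le>j. R n"
    by auto
next
  assume "\<exists>n\<le>j. R n"
  then obtain n where "n \<le> j" "R n"
    by blast
  then have "Inf {enat n | n. R n} \<le> enat n"
    by (blast intro: Inf_lower)
  also have "\<dots> \<le> enat j"
    using \<open>n \<le> j\<close> by simp
  finally show "Inf {enat n | n. R n} \<le> enat j" .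
qed

lemma Inf_enat_eqD:
  assumes eq: "Inf {enat n | n. R n} = enat j"
  shows "R j"
proof -
  obtain n where "n \<le> j" "R n"
    using Inf_enat_le_iff[of R j] eq by auto
  moreover have "j \<le> n"
    using Inf_enat_le_iff[of R n] eq \<open>R n\<close> by auto
  ultimately show ?thesis
    by (simp add: le_antisym)
qed

lemma stopping_time_hitting:
  assumes \<sigma>: "stopping_time T \<sigma>"
    and P: "\<And>n S S'. S \<in> T \<Longrightarrow> S' \<in> node T S n \<Longrightarrow> P n S' = P n S"
  shows "stopping_time T (\<lambda>S. Inf {enat n | n. \<sigma> S \<le> enat n \<and> P n S})"
  unfolding stopping_time_def Inf_enat_le_iff
proof (intro allI ballI)
  fix j S S'
  assume S: "S \<in> T" "S' \<in> node T S j"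
  then have "S' \<in> node T S n" if "n \<le> j" for n
    using that by (simp add: node_def)
  then show "(\<exists>n\<le>j. \<sigma> S' \<le> enat n \<and> P n S') \<longleftrightarrow> (\<exists>n\<le>j. \<sigma> S \<le> enat n \<and> P n S)"
    using stopping_timeD[OF \<sigma> S(1)] P[OF S(1)] by blast
qed

lemma stopping_time_upcrossing:
  assumes na: "\<And>j S S'. S \<in> T \<Longrightarrow> S' \<in> node T S j \<Longrightarrow> f j S' = f j S"
  shows "stopping_time T (up_tau f a b k)" "stopping_time T (up_rho f a b k)"
proof -
  have rho: "stopping_time T (up_rho f a b k)" if "stopping_time T (up_tau f a b k)" for k
    using stopping_time_hitting[OF that, of "\<lambda>n S. f n S \<le> a"] na by (simp add: stopping_time_def)
  show "stopping_time T (up_tau f a b k)"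
  proof (induction k)
    case 0
    show ?case
      by (simp add: stopping_time_def)
  next
    case (Suc k)
    show ?case
      using stopping_time_hitting[OF rho[OF Suc], of "\<lambda>n S. f n S \<ge> b"] na
      by (simp add: stopping_time_def)
  qed
  then show "stopping_time T (up_rho f a b k)"
    by (rule rho)
qed

lemma up_tau_le_up_rho: "up_tau f a b k S \<le> up_rho f a b k S"
  by (auto intro!: Inf_greatest)

lemma up_rho_le_up_tau_Suc: "up_rho f a b k S \<le> up_tau f a b (Suc k) S"
  by (auto simp del: up_rho.simps intro!: Inf_greatest)

lemma up_rho_value: "up_rho f a b k S = enat n \<Longrightarrow> f n S \<le> a"
  using Inf_enat_eqD[of "\<lambda>n. up_tau f a b k S \<le> enat n \<and> f n S \<le> a" n] by simp

lemma up_tau_value: "up_tau f a b (Suc k) S = enat n \<Longrightarrow> b \<le> f n S"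
  using Inf_enat_eqD[of "\<lambda>n. up_rho f a b k S \<le> enat n \<and> b \<le> f n S" n] by simp

section \<open>The exceptional set and the estimate for one crossing\<close>

lemma null_set_not_regular:
  assumes T: "trajectory_set s0 T" and L: "L_ae T"
    and sm: "supermartingale T (\<lambda>j S. ereal (f j S))"
  obtains E where "null_set T E" "\<And>S. S \<in> T \<Longrightarrow> S \<notin> E \<Longrightarrow> regular T f S"
proof -
  let ?N = "{S \<in> T. \<exists>j. \<not> prop_L T S j}"
  let ?A = "{S \<in> T. \<exists>j. \<not> up_down_node T S j \<and> S (Suc j) \<noteq> S j}"
  have N: "null_set T ?N"
    using L by (simp add: L_ae_def)
  have A: "null_set T ?A"
    by (rule null_set_arbitrage[OF T null_set_nonempty[OF N]])
  have "\<exists>F. null_set T F \<and> (\<forall>S\<in>T - F. upper_sigma T j (\<lambda>S. ereal (f (Suc j) S)) S \<le> ereal (f j S))" for j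
    using sm by (simp add: supermartingale_def holds_ae_def)
  then obtain F where F: "\<And>j. null_set T (F j)"
    "\<And>j S. S \<in> T - F j \<Longrightarrow> upper_sigma T j (\<lambda>S. ereal (f (Suc j) S)) S \<le> ereal (f j S)"
    by metis
  show ?thesis
  proof (rule that)
    \<comment> \<open>Regularity can fail in three ways: (L) fails at some time, the path moves at a
      node that is not up-down, or the supermartingale inequality fails at some time.\<close>
    show "null_set T (?N \<union> ?A \<union> (\<Union>j. F j))"
      by (intro null_set_Un[OF T] null_set_UN[OF T] N A F)
    show "regular T f S" if "S \<in> T" "S \<notin> ?N \<union> ?A \<union> (\<Union>j. F j)" for S
      using that F(2) by (auto simp: regular_def)
  qed
qed

text \<open>Divided by \<open>b\<close>, the hedge of \<open>f\<close> starts from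
  \<open>(a + e) / b\<close> and ends at \<open>1\<close> or more on paths off the null set with
  finite \<open>\<tau>\<close>. This is the strategy that \<open>upper_I0_stopped_le\<close>
  requires.\<close>

lemma upper_I0_upcrossing_le:
  assumes T: "trajectory_set s0 T" and L: "L_ae T" and P: "prop_P T"
    and sm: "supermartingale T (\<lambda>j S. ereal (f j S))"
    and nonneg: "\<And>j S. S \<in> T \<Longrightarrow> 0 \<le> f j S"
    and \<rho>: "stopping_time T \<rho>" and \<tau>: "stopping_time T \<tau>" and le: "\<And>S. \<rho> S \<le> \<tau> S"
    and a: "\<And>S n. S \<in> T \<Longrightarrow> \<rho> S = enat n \<Longrightarrow> f n S \<le> a"
    and b: "\<And>S n. S \<in> T \<Longrightarrow> \<tau> S = enat n \<Longrightarrow> b \<le> f n S"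
    and "0 \<le> a" "0 < b"
  shows "upper_I0 T (indicator {S \<in> T. \<tau> S < \<infinity>})
    \<le> ereal (a / b) * upper_I0 T (indicator {S \<in> T. \<rho> S < \<infinity>})" (is "?I1 \<le> _ * ?I2")
proof -
  obtain E where E: "null_set T E" and reg: "\<And>S. S \<in> T \<Longrightarrow> S \<notin> E \<Longrightarrow> regular T f S"
    using null_set_not_regular[OF T L sm] by blast
  obtain S0 where S0: "S0 \<in> T"
    using null_set_nonempty[OF E] by blast
  have na: "f j S' = f j S" if "S \<in> T" "S' \<in> node T S j" for j S S'
    using sm that by (auto simp: supermartingale_def)
  have approx: "?I1 \<le> ereal ((a + e) / b) * ?I2" if "e > 0" for e
  proof -
    obtain G where G: "G \<in> hedges T S0 0"
      and G0: "\<And>S i. S \<in> T \<Longrightarrow> enat i < \<rho> S \<or> \<tau> S \<le> enat i \<Longrightarrow> G i S = 0"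
      and G_nonneg: "\<And>S n. S \<in> T \<Longrightarrow> 0 \<le> portfolio (a + e) G 0 n S"
      and G_ge: "\<And>S n. S \<in> T \<Longrightarrow> regular T f S \<Longrightarrow> \<rho> S \<le> enat n \<Longrightarrow> enat n \<le> \<tau> S \<Longrightarrow>
         f n S \<le> portfolio (a + e) G 0 n S"
      by (rule supermartingale_hedge[OF T S0 P na nonneg \<rho> \<tau> a \<open>0 \<le> a\<close> \<open>e > 0\<close>]) (blast+)
    define G' where "G' i S = G i S / b" for i S
    have G': "portfolio ((a + e) / b) G' 0 n S = portfolio (a + e) G 0 n S / b" for n S
      by (simp add: portfolio_def G'_def add_divide_distrib sum_divide_distrib)
    have "?I1 \<le> upper_I0 T (indicator ({S \<in> T. \<tau> S < \<infinity>} - E))"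
      by (rule upper_I0_Diff_null[OF T E])
    also have "\<dots> \<le> ereal ((a + e) / b) * ?I2"
    proof (rule upper_I0_stopped_le[OF T S0 \<rho>])
      show "G' \<in> hedges T S0 0"
        unfolding G'_def by (rule hedges_comp[OF G, where \<phi> = "\<lambda>i x. x / b"])
    next
      fix S
      assume "S \<in> {S \<in> T. \<tau> S < \<infinity>} - E"
      then have S: "S \<in> T" "\<tau> S < \<infinity>" "regular T f S"
        using reg by auto
      obtain N where N: "\<tau> S = enat N"
        using S(2) by (cases "\<tau> S") auto
      have "\<rho> S < \<infinity>"
        using le[of S] S(2) by (rule le_less_trans)
      moreover have "1 \<le> portfolio ((a + e) / b) G' 0 n S" if "N \<le> n" for n
      proof -
        \<comment> \<open>Trading stops at \<open>\<tau>\<close>, so the level \<open>b\<close>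
          reached there is kept forever.\<close>
        have "portfolio (a + e) G 0 n S = portfolio (a + e) G 0 N S"
          using that
        proof (induction n rule: dec_induct)
          case (step n)
          then show ?case
            using G0[OF S(1), of n] N by (simp add: portfolio_Suc)
        qed simp
        then have "b \<le> portfolio (a + e) G 0 n S"
          using b[OF S(1) N] G_ge[OF S(1,3), of N] le[of S] N by simp
        then show ?thesis
          using \<open>b > 0\<close> by (simp add: G')
      qed
      ultimately show "S \<in> T \<and> \<rho> S < \<infinity> \<and> prop_L T S (the_enat (\<rho> S)) \<and>
          (\<exists>N. \<forall>n\<ge>N. 1 \<le> portfolio ((a + e) / b) G' 0 n S)"
        using S by (auto simp: regular_def)
    qed (use G0 G_nonneg \<open>0 \<le> a\<close> \<open>0 < b\<close> \<open>e > 0\<close> in \<open>auto simp: G' G'_def\<close>)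
    finally show ?thesis .
  qed
  obtain r where r: "?I1 = ereal r"
    using upper_I0_nonneg[OF T S0, of "indicator {S \<in> T. \<tau> S < \<infinity>}"]
      upper_I0_indicator_le_1[OF T S0, of "{S \<in> T. \<tau> S < \<infinity>}"]
    by (cases ?I1) (auto simp: one_ereal_def)
  obtain s where s: "?I2 = ereal s" "s \<le> 1"
    using upper_I0_nonneg[OF T S0, of "indicator {S \<in> T. \<rho> S < \<infinity>}"]
      upper_I0_indicator_le_1[OF T S0, of "{S \<in> T. \<rho> S < \<infinity>}"]
    by (cases ?I2) (auto simp: one_ereal_def)
  have "r \<le> a / b * s"
  proof (rule field_le_epsilon)
    fix d :: real
    assume d: "d > 0"
    \<comment> \<open>The choice \<open>e = d * b\<close> turns the error into \<open>d * s\<close>,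
      which is at most \<open>d\<close>.\<close>
    have "r \<le> (a + d * b) / b * s"
      using approx[of "d * b"] d \<open>b > 0\<close> unfolding r s(1) by simp
    also have "\<dots> = a / b * s + d * s"
      using \<open>b > 0\<close> by (simp add: field_simps)
    also have "\<dots> \<le> a / b * s + d"
      using d s by (simp add: mult_left_le)
    finally show "r \<le> a / b * s + d" .
  qed
  then show ?thesis
    unfolding r s(1) by simp
qed

theorem theorem5p5:
  fixes s0 a b :: real and T :: "traj set" and f :: "nat \<Rightarrow> traj \<Rightarrow> real" and k :: nat
  assumes "trajectory_set s0 T"
    and "L_ae T"
    and "prop_P T"
    and "supermartingale T (\<lambda>j S. ereal (f j S))"
    and "\<forall>j. \<forall>S\<in>T. 0 \<le> f j S"
    and "0 \<le> a" and "a < b"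
  shows "upper_I0 T (indicator {S \<in> T. up_tau f a b (Suc k) S < \<infinity>})
           \<le> ereal (a / b) * upper_I0 T (indicator {S \<in> T. up_rho f a b k S < \<infinity>})
       \<and> ereal (a / b) * upper_I0 T (indicator {S \<in> T. up_rho f a b k S < \<infinity>})
           \<le> ereal (a / b) * upper_I0 T (indicator {S \<in> T. up_tau f a b k S < \<infinity>})
       \<and> upper_I0 T (indicator {S \<in> T. up_tau f a b (Suc k) S < \<infinity>})
           \<le> ereal ((a / b) ^ (k + 1)) * upper_I0 T (indicator {S \<in> T. up_rho f a b 0 S < \<infinity>})
       \<and> ereal ((a / b) ^ (k + 1)) * upper_I0 T (indicator {S \<in> T. up_rho f a b 0 S < \<infinity>})
           \<le> ereal ((a / b) ^ (k + 1))"
proof -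
  define q where "q = a / b"
  have q: "0 \<le> ereal q"
    using assms(6,7) by (simp add: q_def)
  define It where "It k = upper_I0 T (indicator {S \<in> T. up_tau f a b k S < \<infinity>})" for k
  define Ir where "Ir k = upper_I0 T (indicator {S \<in> T. up_rho f a b k S < \<infinity>})" for k
  have na: "f j S' = f j S" if "S \<in> T" "S' \<in> node T S j" for j S S'
    using assms(4) that by (auto simp: supermartingale_def)
  have "null_set T {S \<in> T. \<exists>j. \<not> prop_L T S j}"
    using assms(2) by (simp add: L_ae_def)
  then obtain S0 where S0: "S0 \<in> T"
    using null_set_nonempty by blast
  have up: "It (Suc k) \<le> ereal q * Ir k" for k
    unfolding It_def Ir_def q_def
  proof (rule upper_I0_upcrossing_le[OF assms(1-4)])
    show "stopping_time T (up_rho f a b k)" "stopping_time T (up_tau f a b (Suc k))"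
      by (rule stopping_time_upcrossing[OF na]; assumption)+
    show "up_rho f a b k S \<le> up_tau f a b (Suc k) S" for S
      by (rule up_rho_le_up_tau_Suc)
  qed (use assms(5-7) in \<open>auto intro: up_rho_value up_tau_value simp del: up_tau.simps up_rho.simps\<close>)
  have down: "Ir k \<le> It k" for k
    unfolding It_def Ir_def
  proof (rule upper_I0_mono)
    fix S
    show "(indicator {S \<in> T. up_rho f a b k S < \<infinity>} S :: ereal) \<le> indicator {S \<in> T. up_tau f a b k S < \<infinity>} S"
      using le_less_trans[OF up_tau_le_up_rho[of f a b k S], of \<infinity>]
      by (auto simp: indicator_def simp del: up_tau.simps up_rho.simps)
  qed
  have iter: "It (Suc k) \<le> ereal (q ^ (k + 1)) * Ir 0" for k
  proof (induction k)
    case 0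
    show ?case
      using up[of 0] by simp
  next
    case (Suc k)
    have "It (Suc (Suc k)) \<le> ereal q * Ir (Suc k)"
      by (rule up)
    \<comment> \<open>Here \<open>down\<close> passes from \<open>Ir (Suc k)\<close> to
      \<open>It (Suc k)\<close>, which the induction hypothesis bounds.\<close>
    also have "\<dots> \<le> ereal q * (ereal (q ^ (k + 1)) * Ir 0)"
      by (intro ereal_mult_left_mono q order_trans[OF down Suc])
    also have "\<dots> = ereal (q ^ (Suc k + 1)) * Ir 0"
      by (simp add: mult.assoc[symmetric])
    finally show ?case .
  qed
  have "ereal (q ^ (k + 1)) * Ir 0 \<le> ereal (q ^ (k + 1)) * 1"
    using q upper_I0_indicator_le_1[OF assms(1) S0]
    unfolding Ir_def by (intro ereal_mult_left_mono) auto
  then have "ereal (q ^ (k + 1)) * Ir 0 \<le> ereal (q ^ (k + 1))"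
    by simp
  then show ?thesis
    using up[of k] iter[of k] ereal_mult_left_mono[OF down[of k] q]
    unfolding It_def Ir_def q_def by blast
qed

end
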